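(* (i) For $r\in\{3,4\}$, almost all $r$-uniform hypergraphs are strongly $2$-weighted but not strongly $1$-weighted. (ii) Let $H_n$ be chosen uniformly at random among all $5$-uniform hypergraphs on vertex set $[n]$. Then $\Pr(H_n \text{ is strongly 1-weighted}) = e^{-\sqrt{6/\pi}}+o(1)$ and $\Pr(H_n \text{ is strongly 2-weighted but not strongly 1-weighted}) = 1-e^{-\sqrt{6/\pi}}+o(1)$. (iii) For every $r\ge 6$, almost all $r$-uniform hypergraphs are strongly $1$-weighted.
   Context: An $r$-uniform hypergraph $H=(V,E)$ has every edge of size $r$. Given $\omega:E\to\{1,\dots,w\}$, the induced vertex-coloring is $c(v)=\sum_{e\ni v}\omega(e)$. The coloring is strong if every edge is rainbow (no two vertices of an edge get the same color). $H$ is strongly $w$-weighted if some $\omega:E\to\{1,\dots,w\}$ induces a strong coloring. "Almost all $r$-uniform hypergraphs on $n$ vertices have property $\mathcal P$" means that the number of $r$-uniform hypergraphs on vertex set $[n]$ without $\mathcal P$ is $o\big(2^{\binom{n}{r}}\big)$ as $n\to\infty$ (equivalently, the random hypergraph in which each $r$-subset of $[n]$ is an edge independently with probability $1/2$ has $\mathcal P$ with probability $1-o(1)$). *)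

theory Defs
  imports Complex_Main
begin

text \<open>An r-uniform hypergraph on vertex set [n] = {1..n} is identified with its edge set,
  a set of r-element subsets of {1..n}.\<close>

definition uniform_hypergraphs :: "nat \<Rightarrow> nat \<Rightarrow> nat set set set" where
  "uniform_hypergraphs r n = Pow {S. S \<subseteq> {1..n} \<and> card S = r}"

definition induced_colour :: "nat set set \<Rightarrow> (nat set \<Rightarrow> nat) \<Rightarrow> nat \<Rightarrow> nat" where
  "induced_colour E \<omega> v = (\<Sum>e\<in>{e\<in>E. v \<in> e}. \<omega> e)"

definition strongly_weighted :: "nat \<Rightarrow> nat set set \<Rightarrow> bool" where
  "strongly_weighted w E \<longleftrightarrow>
     (\<exists>\<omega> :: nat set \<Rightarrow> nat. (\<forall>e\<in>E. \<omega> e \<in> {1..w}) \<and>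
        (\<forall>e\<in>E. \<forall>u\<in>e. \<forall>v\<in>e. u \<noteq> v \<longrightarrow> induced_colour E \<omega> u \<noteq> induced_colour E \<omega> v))"

definition frac_with :: "nat \<Rightarrow> (nat set set \<Rightarrow> bool) \<Rightarrow> nat \<Rightarrow> real" where
  "frac_with r P n = real (card {E \<in> uniform_hypergraphs r n. P E}) / 2 ^ (n choose r)"

definition almost_all :: "nat \<Rightarrow> (nat set set \<Rightarrow> bool) \<Rightarrow> bool" where
  "almost_all r P \<longleftrightarrow> (frac_with r (\<lambda>E. \<not> P E) \<longlonglongrightarrow> 0)"

end

(* For one weight the colour of a vertex is its degree, and every pair of vertices lies in an edge
   with high probability, so the hypergraph is strongly 1-weighted essentially iff all degrees differ.
   Two degrees coincide with probability about (pi N)^(-1/2), N = (n - 1 choose r - 1), so the expected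
   number of coincidences is of order n^(2 - (r - 1)/2): it vanishes for r >= 6, tends to sqrt(6/pi)
   for r = 5, and diverges for r <= 4.  The number of coinciding pairs among m vertices with
   m^2 = O(n^((r - 1)/2)) is asymptotically Poisson: its factorial moments are sums over matchings,
   estimated by conditioning on all edges that do not meet the matching in a single vertex, and
   Bonferroni's inequalities turn them into the probability of no coincidence.  For r = 5 all vertices
   may be taken, for r <= 4 the window m = c n^((r - 1)/4) with c large suffices.
   With two weights a colour can be raised by any number up to the degree, and for r >= 3 a greedy
   choice on three classes of edges makes all colours distinct. *)
theory Submission
  imports Defs "HOL-Analysis.Gamma_Function" "HOL-Real_Asymp.Real_Asymp"
begin

section \<open>Uniformly random subsets of a finite set\<close>

text \<open>Degrees are dependent, since an edge through two chosen vertices raises both. Edges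
  meeting the chosen set in exactly one vertex form independent blocks, and they are almost all
  edges at a vertex. The others shift the balance of a pair only by about n^((r - 2)/2), while the
  binomial is flat up to its standard deviation of order n^((r - 1)/2). Overlapping pairs would
  spoil the moments of the plain number of coincidences. Counting only pairs whose degree no third
  vertex of the window shares removes them. The price is a triple coincidence, of probability
  O(m^3/N) = O(1/m) at the critical scale m^2 = O(sqrt N). For r <= 4 the mean over all vertices is
  unbounded; a window keeps it bounded, and a repeated degree in the window is a repeated degree
  overall. With two weights, an edge used to shift one vertex also shifts its other vertices. These
  must lie outside the class being separated, so the classes disturb each other cyclically; the
  cycle is broken by giving one class gaps wide enough to absorb later shifts.\<close>

definition avg :: "'a set \<Rightarrow> ('a set \<Rightarrow> real) \<Rightarrow> real" where
  "avg S f = (\<Sum>E\<in>Pow S. f E) / 2 ^ card S"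

definition pr :: "'a set \<Rightarrow> ('a set \<Rightarrow> bool) \<Rightarrow> real" where
  "pr S P = avg S (\<lambda>E. of_bool (P E))"

lemma avg_cong: "(\<And>E. E \<subseteq> S \<Longrightarrow> f E = g E) \<Longrightarrow> avg S f = avg S g"
  unfolding avg_def by (metis (mono_tags, lifting) PowD sum.cong)

lemma avg_mono: "(\<And>E. E \<subseteq> S \<Longrightarrow> f E \<le> g E) \<Longrightarrow> avg S f \<le> avg S g"
  unfolding avg_def by (intro divide_right_mono sum_mono) auto

lemma avg_nonneg: "(\<And>E. E \<subseteq> S \<Longrightarrow> 0 \<le> f E) \<Longrightarrow> 0 \<le> avg S f"
  unfolding avg_def by (intro divide_nonneg_nonneg sum_nonneg) auto

lemma avg_add: "avg S (\<lambda>E. f E + g E) = avg S f + avg S g"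
  unfolding avg_def by (simp add: sum.distrib add_divide_distrib)

lemma avg_diff: "avg S (\<lambda>E. f E - g E) = avg S f - avg S g"
  unfolding avg_def by (simp add: sum_subtractf diff_divide_distrib)

lemma avg_cmult: "avg S (\<lambda>E. c * f E) = c * avg S f"
  unfolding avg_def by (simp add: sum_distrib_left)

lemma avg_cmult_right: "avg S (\<lambda>E. f E * c) = avg S f * c"
  using avg_cmult[of S c f] by (simp add: mult.commute)

lemma avg_const: "finite S \<Longrightarrow> avg S (\<lambda>_. c) = c"
  unfolding avg_def by (simp add: card_Pow)

lemma avg_sum: "avg S (\<lambda>E. \<Sum>i\<in>I. f i E) = (\<Sum>i\<in>I. avg S (f i))"
  unfolding avg_def by (subst sum.swap) (simp add: sum_divide_distrib)

lemma pr_eq_card: "finite S \<Longrightarrow> pr S P = card {E\<in>Pow S. P E} / 2 ^ card S"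
  unfolding pr_def avg_def by (simp add: of_bool_def sum.If_cases Int_def)

lemma pr_nonneg: "0 \<le> pr S P"
  unfolding pr_def by (rule avg_nonneg) simp

lemma pr_mono: "(\<And>E. E \<subseteq> S \<Longrightarrow> P E \<Longrightarrow> Q E) \<Longrightarrow> pr S P \<le> pr S Q"
  unfolding pr_def by (rule avg_mono) auto

lemma pr_cong: "(\<And>E. E \<subseteq> S \<Longrightarrow> P E = Q E) \<Longrightarrow> pr S P = pr S Q"
  unfolding pr_def by (rule avg_cong) auto

lemma pr_compl: "finite S \<Longrightarrow> pr S (\<lambda>E. \<not> P E) = 1 - pr S P"
proof -
  assume "finite S"
  have "pr S (\<lambda>E. \<not> P E) = avg S (\<lambda>E. 1 - of_bool (P E))"
    unfolding pr_def by (rule avg_cong) auto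
  with \<open>finite S\<close> show ?thesis by (simp add: avg_diff avg_const pr_def)
qed

lemma pr_or_le: "pr S (\<lambda>E. P E \<or> Q E) \<le> pr S P + pr S Q"
  unfolding pr_def avg_add[symmetric] by (rule avg_mono) auto

lemma pr_bex_le: "finite I \<Longrightarrow> pr S (\<lambda>E. \<exists>i\<in>I. P i E) \<le> (\<Sum>i\<in>I. pr S (P i))"
proof -
  assume I: "finite I"
  have "of_bool (\<exists>i\<in>I. P i E) \<le> (\<Sum>i\<in>I. of_bool (P i E) :: real)" for E
  proof (cases "\<exists>i\<in>I. P i E")
    case True
    then obtain i where i: "i \<in> I" "P i E" by blast
    have "(of_bool (P i E) :: real) \<le> (\<Sum>i\<in>I. of_bool (P i E))"
      using I i(1) by (intro member_le_sum) auto
    with i True show ?thesis by simp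
  qed (simp add: sum_nonneg)
  then show ?thesis unfolding pr_def avg_sum[symmetric] by (intro avg_mono)
qed

lemma pr_bex_le_const:
  fixes c :: real
  assumes "finite I" "\<And>i. i \<in> I \<Longrightarrow> pr S (P i) \<le> c"
  shows "pr S (\<lambda>E. \<exists>i\<in>I. P i E) \<le> card I * c"
  using pr_bex_le[OF assms(1), of S P] sum_mono[of I "\<lambda>i. pr S (P i)" "\<lambda>_. c"] assms(2) by simp

text \<open>Independence in the form of Fubini: a uniform subset of a disjoint union is a pair of
  independent uniform subsets. The outer average plays the role of conditioning on the edges in
  \<open>A\<close>.\<close>

lemma avg_Un:
  assumes "finite A" "finite B" "A \<inter> B = {}"
  shows "avg (A \<union> B) f = avg A (\<lambda>X. avg B (\<lambda>Y. f (X \<union> Y)))"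
proof -
  have "(\<Sum>E\<in>Pow (A \<union> B). f E) = (\<Sum>(X, Y)\<in>Pow A \<times> Pow B. f (X \<union> Y))"
    by (rule sum.reindex_bij_witness[where i = "\<lambda>(X, Y). X \<union> Y" and j = "\<lambda>E. (E \<inter> A, E \<inter> B)"])
      (use assms(3) in \<open>auto intro!: arg_cong[where f = f]\<close>)
  also have "\<dots> = (\<Sum>X\<in>Pow A. \<Sum>Y\<in>Pow B. f (X \<union> Y))"
    using assms by (subst sum.cartesian_product) auto
  finally show ?thesis
    using assms by (simp add: avg_def card_Un_disjoint power_add sum_divide_distrib mult.commute)
qed

lemma avg_insert:
  assumes "finite S" "x \<notin> S"
  shows "avg (insert x S) f = (avg S f + avg S (\<lambda>E. f (insert x E))) / 2"
proof -
  have "avg (S \<union> {x}) f = avg S (\<lambda>X. avg {x} (\<lambda>Y. f (X \<union> Y)))"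
    using assms by (intro avg_Un) auto
  also have "\<dots> = avg S (\<lambda>X. (f X + f (insert x X)) * (1 / 2))"
    by (rule avg_cong) (simp add: avg_def Pow_insert)
  also have "\<dots> = (avg S f + avg S (\<lambda>E. f (insert x E))) * (1 / 2)"
    by (simp only: avg_cmult_right avg_add)
  finally show ?thesis by simp
qed

lemma avg_Int:
  assumes "finite S" "A \<subseteq> S"
  shows "avg S (\<lambda>E. f (E \<inter> A)) = avg A f"
proof -
  have "avg (A \<union> (S - A)) (\<lambda>E. f (E \<inter> A)) = avg A (\<lambda>X. avg (S - A) (\<lambda>Y. f ((X \<union> Y) \<inter> A)))"
    using assms finite_subset by (intro avg_Un) auto
  also have "\<dots> = avg A (\<lambda>X. avg (S - A) (\<lambda>_. f X))"
    by (intro avg_cong arg_cong[where f = f]) auto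
  finally show ?thesis
    using assms by (simp add: avg_const Un_absorb1)
qed

text \<open>Factor \<open>i\<close> sees \<open>E\<close> only through block \<open>B i\<close>, so
  the factors are independent and expectation is multiplicative.\<close>

lemma avg_prod_blocks:
  assumes "finite I" "\<And>i. i \<in> I \<Longrightarrow> finite (B i)" "disjoint_family_on B I"
  shows "avg (\<Union>i\<in>I. B i) (\<lambda>E. \<Prod>i\<in>I. g i (E \<inter> B i)) = (\<Prod>i\<in>I. avg (B i) (g i))"
  using assms
proof (induction I rule: finite_induct)
  case empty
  then show ?case by (simp add: avg_def)
next
  case (insert i I)
  have dis: "B i \<inter> (\<Union>j\<in>I. B j) = {}"
    using insert.hyps insert.prems(2) unfolding disjoint_family_on_def by fastforce
  have "avg (B i \<union> (\<Union>j\<in>I. B j)) (\<lambda>E. \<Prod>j\<in>insert i I. g j (E \<inter> B j))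
      = avg (B i) (\<lambda>X. avg (\<Union>j\<in>I. B j) (\<lambda>Y. \<Prod>j\<in>insert i I. g j ((X \<union> Y) \<inter> B j)))"
    using insert dis by (intro avg_Un) auto
  also have "\<dots> = avg (B i) (\<lambda>X. avg (\<Union>j\<in>I. B j) (\<lambda>Y. g i X * (\<Prod>j\<in>I. g j (Y \<inter> B j))))"
  proof (intro avg_cong)
    fix X Y assume XY: "X \<subseteq> B i" "Y \<subseteq> (\<Union>j\<in>I. B j)"
    have "(X \<union> Y) \<inter> B i = X" using XY dis by auto
    moreover have "(X \<union> Y) \<inter> B j = Y \<inter> B j" if "j \<in> I" for j
      using XY dis that by auto
    ultimately show "(\<Prod>j\<in>insert i I. g j ((X \<union> Y) \<inter> B j)) = g i X * (\<Prod>j\<in>I. g j (Y \<inter> B j))"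
      using insert.hyps by simp
  qed
  also have "\<dots> = avg (B i) (g i) * (\<Prod>j\<in>I. avg (B j) (g j))"
    using insert by (simp add: avg_cmult avg_cmult_right disjoint_family_on_def)
  finally show ?case using insert.hyps by simp
qed

text \<open>Variance of a weighted sum of independent fair bits. Signed weights are allowed because
  the lemma is also applied to differences of two degrees.\<close>

lemma avg_centred_square:
  fixes h :: "'a \<Rightarrow> real"
  assumes "finite S"
  shows "avg S (\<lambda>E. ((\<Sum>e\<in>E. h e) - (\<Sum>e\<in>S. h e) / 2)\<^sup>2) = (\<Sum>e\<in>S. (h e)\<^sup>2) / 4"
  using assms
proof (induction S rule: finite_induct)
  case empty
  then show ?case by (simp add: avg_def)
next
  case (insert x S)
  let ?c = "\<lambda>E. (\<Sum>e\<in>E. h e) - (\<Sum>e\<in>S. h e) / 2"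
  have "avg S (\<lambda>E. ((\<Sum>e\<in>E. h e) - (\<Sum>e\<in>insert x S. h e) / 2)\<^sup>2)
      + avg S (\<lambda>E. ((\<Sum>e\<in>insert x E. h e) - (\<Sum>e\<in>insert x S. h e) / 2)\<^sup>2)
      = avg S (\<lambda>E. (?c E - h x / 2)\<^sup>2 + (?c E + h x / 2)\<^sup>2)"
    unfolding avg_add[symmetric]
  proof (rule avg_cong)
    fix E assume "E \<subseteq> S"
    then have "finite E" "x \<notin> E" using insert.hyps finite_subset by auto
    then show "((\<Sum>e\<in>E. h e) - (\<Sum>e\<in>insert x S. h e) / 2)\<^sup>2
        + ((\<Sum>e\<in>insert x E. h e) - (\<Sum>e\<in>insert x S. h e) / 2)\<^sup>2
        = (?c E - h x / 2)\<^sup>2 + (?c E + h x / 2)\<^sup>2"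
      using insert.hyps by (simp add: power2_eq_square field_simps)
  qed
  \<comment> \<open>The cross terms of the two choices for \<open>x\<close> cancel.\<close>
  also have "\<dots> = avg S (\<lambda>E. 2 * (?c E)\<^sup>2 + (h x)\<^sup>2 / 2)"
    by (rule avg_cong) (simp add: field_simps power2_eq_square)
  also have "\<dots> = (\<Sum>e\<in>S. (h e)\<^sup>2) / 2 + (h x)\<^sup>2 / 2"
    using insert by (simp add: avg_add avg_cmult avg_const)
  finally show ?case
    using insert.hyps by (subst avg_insert) auto
qed

lemma chebyshev_card_Int:
  assumes "finite S" "D \<subseteq> S" "0 < t"
  shows "pr S (\<lambda>E. t \<le> \<bar>card (E \<inter> D) - card D / 2\<bar>) \<le> card D / (4 * t\<^sup>2)"
proof -
  let ?h = "\<lambda>e. of_bool (e \<in> D) :: real"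
  have fin: "finite D" using assms finite_subset by blast
  have h: "(\<Sum>e\<in>E. ?h e) = card (E \<inter> D)" if "E \<subseteq> S" for E
    using finite_subset[OF that assms(1)] by (simp add: of_bool_def sum.If_cases)
  have "pr S (\<lambda>E. t \<le> \<bar>card (E \<inter> D) - card D / 2\<bar>)
      \<le> avg S (\<lambda>E. ((\<Sum>e\<in>E. ?h e) - (\<Sum>e\<in>S. ?h e) / 2)\<^sup>2 * (1 / t\<^sup>2))"
    unfolding pr_def
  proof (rule avg_mono)
    fix E assume E: "E \<subseteq> S"
    let ?d = "real (card (E \<inter> D)) - card D / 2"
    have eq: "(\<Sum>e\<in>E. ?h e) - (\<Sum>e\<in>S. ?h e) / 2 = ?d"
      using h[OF E] h[of S] assms by (simp add: Int_absorb1)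
    have "of_bool (t \<le> \<bar>?d\<bar>) \<le> ?d\<^sup>2 * (1 / t\<^sup>2)"
    proof (cases "t \<le> \<bar>?d\<bar>")
      case True
      then have "t\<^sup>2 \<le> ?d\<^sup>2" using assms(3) by (metis abs_le_square_iff abs_of_pos)
      with assms(3) True show ?thesis by simp
    qed simp
    with eq show "of_bool (t \<le> \<bar>?d\<bar>) \<le> ((\<Sum>e\<in>E. ?h e) - (\<Sum>e\<in>S. ?h e) / 2)\<^sup>2 * (1 / t\<^sup>2)"
      by simp
  qed
  also have "\<dots> = (\<Sum>e\<in>S. (?h e)\<^sup>2) / 4 * (1 / t\<^sup>2)"
    using assms by (simp only: avg_cmult_right avg_centred_square)
  also have "(\<Sum>e\<in>S. (?h e)\<^sup>2) = card D"
    using h[of S] assms by (simp add: Int_absorb1 power2_eq_square flip: of_bool_conj)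
  finally show ?thesis by simp
qed

lemma pr_card_eq: "finite B \<Longrightarrow> pr B (\<lambda>Y. card Y = j) = (card B choose j) / 2 ^ card B"
  by (simp add: pr_eq_card n_subsets)

section \<open>Binomial coefficients\<close>

text \<open>The probability of N heads in 2N fair tosses, equivalently (by Vandermonde) that two
  independent fair binomials of size N agree.\<close>

definition central :: "nat \<Rightarrow> real" where
  "central N = ((2 * N) choose N) / 4 ^ N"

text \<open>This ratio drives both the explicit bound and the identification with Wallis'
  product.\<close>

lemma central_Suc: "central (Suc N) = central N * ((2 * N + 1) / (2 * N + 2))"
proof -
  have "Suc N * (2 * Suc N choose Suc N) = (2 * Suc N) * (Suc (2 * N) choose N)"
    using Suc_times_binomial_eq[of "Suc (2 * N)" N] by simp
  moreover have "Suc N * (Suc (2 * N) choose N) = Suc (2 * N) * (2 * N choose N)"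
    using Suc_times_binomial_eq[of "2 * N" N] binomial_symmetric[of N "Suc (2 * N)"]
    by (simp del: binomial_Suc_Suc)
  ultimately have "Suc N * (Suc N * (2 * Suc N choose Suc N)) = 2 * Suc N * (Suc (2 * N) * (2 * N choose N))"
    by (metis mult.assoc mult.left_commute)
  then have "real (Suc N) * (real (Suc N) * real (2 * Suc N choose Suc N))
      = 2 * real (Suc N) * (real (Suc (2 * N)) * real (2 * N choose N))"
    by (metis of_nat_mult of_nat_numeral)
  then have "real (Suc N) * (real (Suc N) * real (2 * Suc N choose Suc N))
      = real (Suc N) * (2 * real (Suc (2 * N)) * real (2 * N choose N))"
    by (simp only: ac_simps)
  then have eq: "real (Suc N) * real (2 * Suc N choose Suc N) = 2 * real (Suc (2 * N)) * real (2 * N choose N)"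
    by (metis mult_cancel_left nat.distinct(1) of_nat_eq_0_iff)
  have "b / (4 * d) = c / d * ((2 * x + 1) / (2 * x + 2))"
    if "(x + 1) * b = 2 * (2 * x + 1) * c" "0 \<le> x" "0 < d" for b c d x :: real
  proof -
    have "b * (d * (2 * x + 2)) = 2 * d * ((x + 1) * b)" by (simp add: algebra_simps)
    also have "\<dots> = c * (2 * x + 1) * (4 * d)" unfolding that(1) by (simp add: algebra_simps)
    finally have "b / (4 * d) = c * (2 * x + 1) / (d * (2 * x + 2))"
      using that by (intro frac_eq_eq[THEN iffD2]) auto
    then show ?thesis by simp
  qed
  from this[of "real N" "real (2 * Suc N choose Suc N)" "real (2 * N choose N)" "4 ^ N"]
  show ?thesis
    using eq by (simp add: central_def add.commute del: binomial_Suc_Suc mult_Suc_right)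
qed

lemma central_pos: "0 < central N"
  by (simp add: central_def)

text \<open>The quantity \<open>(central N)\<^sup>2 * (2 * N + 1)\<close> starts at 1 and does not
  increase, because (2N + 1)(2N + 3) <= (2N + 2)^2.\<close>

lemma central_le: "central N \<le> 1 / sqrt (2 * N + 1)"
proof -
  have "(central N)\<^sup>2 * (2 * N + 1) \<le> 1"
  proof (induction N)
    case (Suc N)
    have "(central (Suc N))\<^sup>2 * (2 * Suc N + 1)
        = ((central N)\<^sup>2 * (2 * N + 1)) * ((2 * N + 1) * (2 * N + 3) / (2 * N + 2)\<^sup>2)"
      by (simp add: central_Suc power2_eq_square field_simps)
    also have "((central N)\<^sup>2 * (2 * N + 1)) * ((2 * N + 1) * (2 * N + 3) / (2 * N + 2)\<^sup>2) \<le> 1 * 1"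
    proof (intro mult_mono Suc.IH)
      have "(2 * y + 1) * (2 * y + 3) / (2 * y + 2)\<^sup>2 \<le> 1" if "0 \<le> y" for y :: real
        using that by (subst divide_le_eq_1_pos) (auto simp: power2_eq_square algebra_simps intro!: add_pos_nonneg)
      from this[of "real N"]
      show "real ((2 * N + 1) * (2 * N + 3)) / real ((2 * N + 2)\<^sup>2) \<le> 1"
        by (simp only: of_nat_mult of_nat_add of_nat_power of_nat_numeral of_nat_1)
    qed auto
    finally show ?case by simp
  qed (simp add: central_def)
  then have "(central N)\<^sup>2 \<le> (1 / sqrt (2 * N + 1))\<^sup>2"
    by (simp add: power_divide field_simps)
  then show ?thesis by (rule power2_le_imp_le) simp
qed

text \<open>Anticoncentration: whatever value a degree has to hit, it does so with probability
  O(N^(-1/2)). This crude form serves where the exact constant is irrelevant.\<close>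

lemma binomial_prob_le: "(N choose j) / 2 ^ N \<le> 1 / sqrt (N + 1)"
proof (cases "even N")
  case True
  then obtain K where K: "N = 2 * K" by blast
  have "(N choose j) / 2 ^ N \<le> central K"
    unfolding central_def K power_mult
    by (intro divide_mono of_nat_mono) (use binomial_maximum'[of K j] in auto)
  with central_le[of K] K show ?thesis by (simp add: add.commute)
next
  case False
  then obtain K where K: "N = 2 * K + 1" by (elim oddE)
  \<comment> \<open>An odd row is compared with the next, even one, whose middle entry is twice the
    maximum of the odd row.\<close>
  have "(2 * Suc K choose Suc K) = 2 * (N choose K)"
    using K binomial_symmetric[of K "Suc (2 * K)"] by simp
  moreover have "N choose j \<le> N choose K"
    using binomial_maximum[of N j] K by simp
  ultimately have "2 * real (N choose j) \<le> (2 * Suc K choose Suc K)" by linarith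
  moreover have "2 ^ N = 2 * (4 ^ K :: real)" using K by (simp add: power_mult)
  ultimately have "(N choose j) / 2 ^ N \<le> central (Suc K)"
    unfolding central_def by (simp add: field_simps del: binomial_Suc_Suc)
  also have "\<dots> \<le> 1 / sqrt (2 * Suc K + 1)" by (rule central_le)
  also have "\<dots> \<le> 1 / sqrt (N + 1)"
    using K by (intro divide_left_mono real_sqrt_le_mono) (auto intro!: mult_pos_pos)
  finally show ?thesis by (simp add: add.commute)
qed

text \<open>The step from x to x + 1 loses at most the fraction (2x + 1)/N of the central
  coefficient, and the odd numbers add up to a square. Offsets of order o(sqrt N) are therefore
  harmless.\<close>

lemma binomial_near_centre:
  assumes "x \<le> N"
  shows "real (2 * N choose N) * (1 - (real x)\<^sup>2 / N) \<le> (2 * N choose (N + x))"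
  using assms
proof (induction x)
  case (Suc x)
  have "Suc (N + x) * (2 * N choose Suc (N + x)) = (2 * N - (N + x)) * (2 * N choose (N + x))"
    using binomial_absorb_comp[of "2 * N" "N + x"] Suc.prems
    by (metis binomial_absorption binomial_absorb_comp)
  then have "real (Suc (N + x)) * (2 * N choose Suc (N + x)) = real (N - x) * (2 * N choose (N + x))"
    by (metis (no_types, lifting) add_diff_cancel_left diff_diff_left mult_2 of_nat_mult)
  then have step: "real (2 * N choose (N + Suc x))
      = real (2 * N choose (N + x)) - real (2 * N choose (N + x)) * ((2 * x + 1) / (N + x + 1))"
    using Suc.prems by (simp add: field_simps of_nat_diff)
  have "real (2 * N choose (N + x)) * ((2 * x + 1) / (N + x + 1))
      \<le> real (2 * N choose N) * ((2 * x + 1) / N)"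
    using Suc.prems by (intro mult_mono of_nat_mono binomial_maximum' divide_left_mono) auto
  moreover have "real (2 * N choose N) * (1 - (real (Suc x))\<^sup>2 / N)
      = real (2 * N choose N) * (1 - (real x)\<^sup>2 / N) - real (2 * N choose N) * ((2 * x + 1) / N)"
    by (simp add: power2_eq_square algebra_simps add_divide_distrib)
  ultimately show ?case
    using step Suc by linarith
qed simp

text \<open>The partial Wallis product is exactly the reciprocal of
  \<open>(central n)\<^sup>2 * (2 * n + 1)\<close>, so no Stirling formula is involved.\<close>

lemma central_asymp: "(\<lambda>N. central N * sqrt N) \<longlonglongrightarrow> 1 / sqrt pi"
proof -
  have w: "(\<Prod>k=1..n. (4 * real k ^ 2) / (4 * real k ^ 2 - 1)) = 1 / ((central n)\<^sup>2 * (2 * n + 1))" for n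
  proof (induction n)
    case (Suc n)
    have "4 * real (Suc n) ^ 2 - 1 = (2 * n + 1) * (2 * n + 3)"
      by (simp add: power2_eq_square algebra_simps)
    then have "(\<Prod>k=1..Suc n. (4 * real k ^ 2) / (4 * real k ^ 2 - 1))
        = 1 / ((central n)\<^sup>2 * (2 * n + 1)) * (4 * real (Suc n) ^ 2 / ((2 * n + 1) * (2 * n + 3)))"
      using Suc.IH by simp
    also have "\<dots> = 1 / ((central (Suc n))\<^sup>2 * (2 * Suc n + 1))"
    proof -
      have "1 / (c\<^sup>2 * a) * (4 * s\<^sup>2 / (a * b)) = 1 / ((c * (a / (2 * s)))\<^sup>2 * b)"
        if "c > 0" "a > 0" "b > 0" "s > 0" for a b c s :: real
        using that by (simp add: power2_eq_square field_simps)
      from this[OF central_pos, of "2 * n + 1" "2 * n + 3" "real (Suc n)" n] show ?thesis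
        by (simp add: central_Suc algebra_simps)
    qed
    finally show ?case .
  qed (simp add: central_def)
  have "(\<lambda>n. 1 / ((central n)\<^sup>2 * (2 * n + 1))) \<longlonglongrightarrow> pi / 2"
    using wallis unfolding w .
  then have "(\<lambda>n. inverse (1 / ((central n)\<^sup>2 * (2 * n + 1)))) \<longlonglongrightarrow> inverse (pi / 2)"
    by (intro tendsto_inverse) auto
  then have "(\<lambda>n. (central n)\<^sup>2 * (2 * n + 1)) \<longlonglongrightarrow> 2 / pi" by simp
  moreover have "(\<lambda>n. real n / (2 * n + 1)) \<longlonglongrightarrow> 1 / 2" by real_asymp
  ultimately have "(\<lambda>n. (central n)\<^sup>2 * (2 * n + 1) * (real n / (2 * n + 1))) \<longlonglongrightarrow> 2 / pi * (1 / 2)"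
    by (rule tendsto_mult)
  then have "(\<lambda>n. (central n)\<^sup>2 * real n) \<longlonglongrightarrow> 1 / pi"
    by (rule filterlim_cong[THEN iffD1, rotated -1]) (auto simp: field_simps intro!: always_eventually)
  then have "(\<lambda>n. sqrt ((central n)\<^sup>2 * real n)) \<longlonglongrightarrow> sqrt (1 / pi)"
    by (rule tendsto_real_sqrt)
  then show ?thesis
    using central_pos by (simp add: real_sqrt_mult real_sqrt_divide less_imp_le)
qed

section \<open>Degrees\<close>

definition edges :: "nat \<Rightarrow> nat \<Rightarrow> nat set set" where
  "edges r n = {e. e \<subseteq> {1..n} \<and> card e = r}"

definition deg :: "nat set set \<Rightarrow> nat \<Rightarrow> nat" where
  "deg E v = card {e\<in>E. v \<in> e}"

lemma finite_edges [simp]: "finite (edges r n)"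
  unfolding edges_def by simp

lemma finite_subset_edges: "E \<subseteq> edges r n \<Longrightarrow> finite E"
  using finite_subset by fastforce

lemma finite_edge: "e \<in> edges r n \<Longrightarrow> finite e"
  unfolding edges_def using finite_subset by auto

lemma card_edges: "card (edges r n) = n choose r"
  unfolding edges_def using n_subsets[of "{1..n}" r] by simp

section \<open>Counting edges with a prescribed trace on a vertex set\<close>

lemma card_fixed_Int_edges:
  assumes "A \<subseteq> T" "T \<subseteq> {1..n}" "card A \<le> r"
  shows "card {e\<in>edges r n. e \<inter> T = A} = (n - card T) choose (r - card A)"
proof -
  have fin: "finite T" "finite A" using assms finite_subset by (auto intro: finite_subset)
  let ?B = "{B. B \<subseteq> {1..n} - T \<and> card B = r - card A}"
  have "{e\<in>edges r n. e \<inter> T = A} = (\<lambda>B. A \<union> B) ` ?B"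
  proof (intro equalityI subsetI)
    fix e assume e: "e \<in> {e\<in>edges r n. e \<inter> T = A}"
    then have "e - T \<in> ?B"
      using fin finite_edge[of e r n] card_Diff_subset_Int[of e T] by (auto simp: edges_def)
    moreover have "e = A \<union> (e - T)" using e assms by auto
    ultimately show "e \<in> (\<lambda>B. A \<union> B) ` ?B" by blast
  next
    fix e assume "e \<in> (\<lambda>B. A \<union> B) ` ?B"
    then obtain B where B: "e = A \<union> B" "B \<subseteq> {1..n} - T" "card B = r - card A" by blast
    then have "finite B" "A \<inter> B = {}" using assms by (auto intro: finite_subset)
    then show "e \<in> {e\<in>edges r n. e \<inter> T = A}"
      using B assms fin by (auto simp: edges_def card_Un_disjoint)
  qed
  moreover have "inj_on (\<lambda>B. A \<union> B) ?B"
    using assms by (intro inj_onI) blast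
  ultimately have "card {e\<in>edges r n. e \<inter> T = A} = card ?B"
    by (simp add: card_image)
  also have "\<dots> = (n - card T) choose (r - card A)"
    using n_subsets[of "{1..n} - T" "r - card A"] assms fin by (simp add: card_Diff_subset)
  finally show ?thesis .
qed

lemma card_edges_superset:
  assumes "A \<subseteq> {1..n}" "card A \<le> r"
  shows "card {e\<in>edges r n. A \<subseteq> e} = (n - card A) choose (r - card A)"
proof -
  have "{e\<in>edges r n. A \<subseteq> e} = {e\<in>edges r n. e \<inter> A = A}" by auto
  then show ?thesis using card_fixed_Int_edges[of A A n r] assms by simp
qed

lemma deg_edges:
  assumes "v \<in> {1..n}" "1 \<le> r"
  shows "deg (edges r n) v = (n - 1) choose (r - 1)"
  using card_edges_superset[of "{v}" n r] assms by (simp add: deg_def)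

text \<open>For distinct \<open>t\<close> these sets are disjoint, so conditionally on all other edges the degrees of
  the vertices of \<open>T\<close> are independent binomials plus constants.\<close>

definition solo :: "nat \<Rightarrow> nat \<Rightarrow> nat set \<Rightarrow> nat \<Rightarrow> nat set set" where
  "solo r n T t = {e\<in>edges r n. e \<inter> T = {t}}"

lemma solo_subset: "solo r n T t \<subseteq> edges r n"
  by (auto simp: solo_def)

lemma finite_solo [simp]: "finite (solo r n T t)"
  using solo_subset finite_subset_edges by blast

lemma card_solo:
  assumes "t \<in> T" "T \<subseteq> {1..n}" "1 \<le> r"
  shows "card (solo r n T t) = (n - card T) choose (r - 1)"
  unfolding solo_def using card_fixed_Int_edges[of "{t}" T n r] assms by simp

lemma solo_disjoint: "s \<noteq> t \<Longrightarrow> solo r n T s \<inter> solo r n T t = {}"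
  by (auto simp: solo_def)

text \<open>A newly revealed edge meets \<open>T\<close> in one vertex of \<open>A\<close> only, so
  it changes one degree in \<open>T\<close>. Vertices of \<open>T - A\<close> keep the degree they
  have in \<open>X\<close> and can serve as fixed targets.\<close>

lemma deg_Un_solo:
  assumes "A \<subseteq> T" "t \<in> T" "X \<subseteq> edges r n - (\<Union>a\<in>A. solo r n T a)" "Y \<subseteq> (\<Union>a\<in>A. solo r n T a)"
  shows "deg (X \<union> Y) t = deg X t + card (Y \<inter> solo r n T t)"
    and "t \<notin> A \<Longrightarrow> Y \<inter> solo r n T t = {}"
proof -
  have "e \<in> solo r n T t" if e: "e \<in> Y" "t \<in> e" for e
  proof -
    obtain a where "e \<in> edges r n" "e \<inter> T = {a}"
      using e(1) assms(4) by (auto simp: solo_def)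
    moreover from this(2) have "a = t" using e(2) assms(2) by auto
    ultimately show ?thesis by (simp add: solo_def)
  qed
  then have Y: "{e\<in>Y. t \<in> e} = Y \<inter> solo r n T t"
    by (auto simp: solo_def)
  have fin: "finite X" "finite Y"
    using assms(3,4) solo_subset[of r n T] by (auto intro!: finite_subset_edges[of _ r n])
  have "{e\<in>X \<union> Y. t \<in> e} = {e\<in>X. t \<in> e} \<union> {e\<in>Y. t \<in> e}" by auto
  moreover have "{e\<in>X. t \<in> e} \<inter> {e\<in>Y. t \<in> e} = {}" using assms(3,4) by auto
  ultimately show "deg (X \<union> Y) t = deg X t + card (Y \<inter> solo r n T t)"
    unfolding deg_def using fin Y by (simp add: card_Un_disjoint)
  show "t \<notin> A \<Longrightarrow> Y \<inter> solo r n T t = {}"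
    using assms(4) solo_disjoint[of _ t r n T] by fast
qed

lemma of_bool_ball_prod: "finite A \<Longrightarrow> of_bool (\<forall>a\<in>A. P a) = (\<Prod>a\<in>A. of_bool (P a) :: real)"
  by (induction A rule: finite_induct) auto

text \<open>Since \<open>f a\<close> lies outside \<open>A\<close>, its degree is determined by the
  exposed edges. Each \<open>a\<close> must then hit a fixed value with its own independent block,
  so every equation contributes one anticoncentration factor.\<close>

lemma pr_degrees_eq_le:
  assumes T: "T \<subseteq> {1..n}" and A: "A \<subseteq> T" and f: "\<And>a. a \<in> A \<Longrightarrow> f a \<in> T - A" and r: "1 \<le> r"
  shows "pr (edges r n) (\<lambda>E. \<forall>a\<in>A. deg E a = deg E (f a))
    \<le> (1 / sqrt (((n - card T) choose (r - 1)) + 1)) ^ card A"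
proof -
  let ?B = "solo r n T" and ?N = "(n - card T) choose (r - 1)"
  let ?U = "\<Union>a\<in>A. solo r n T a"
  let ?R = "edges r n - ?U"
  have finA: "finite A" using A T by (meson finite_atLeastAtMost finite_subset)
  have U: "?U \<subseteq> edges r n" using solo_subset by blast
  have "pr (edges r n) (\<lambda>E. \<forall>a\<in>A. deg E a = deg E (f a))
      = avg (?R \<union> ?U) (\<lambda>E. of_bool (\<forall>a\<in>A. deg E a = deg E (f a)))"
    using U by (simp add: pr_def Un_absorb2)
  also have "\<dots> = avg ?R (\<lambda>X. avg ?U (\<lambda>Y. of_bool (\<forall>a\<in>A. deg (X \<union> Y) a = deg (X \<union> Y) (f a))))"
    using U finA by (intro avg_Un) auto
  also have "\<dots> \<le> avg ?R (\<lambda>_. (1 / sqrt (?N + 1)) ^ card A)"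
  proof (rule avg_mono)
    fix X assume X: "X \<subseteq> ?R"
    have "avg ?U (\<lambda>Y. of_bool (\<forall>a\<in>A. deg (X \<union> Y) a = deg (X \<union> Y) (f a)))
        = avg ?U (\<lambda>Y. \<Prod>a\<in>A. of_bool (deg X a + card (Y \<inter> ?B a) = deg X (f a)))"
    proof (rule avg_cong)
      fix Y assume Y: "Y \<subseteq> ?U"
      have "deg (X \<union> Y) a = deg X a + card (Y \<inter> ?B a)" "deg (X \<union> Y) (f a) = deg X (f a)" if "a \<in> A" for a
        using deg_Un_solo[OF A _ X Y] f[OF that] that A by auto
      then show "of_bool (\<forall>a\<in>A. deg (X \<union> Y) a = deg (X \<union> Y) (f a))
          = (\<Prod>a\<in>A. of_bool (deg X a + card (Y \<inter> ?B a) = deg X (f a)) :: real)"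
        using finA by (simp add: of_bool_ball_prod)
    qed
    also have "\<dots> = (\<Prod>a\<in>A. avg (?B a) (\<lambda>Y. of_bool (deg X a + card Y = deg X (f a))))"
      using finA solo_disjoint
      by (intro avg_prod_blocks[where g = "\<lambda>a Y. of_bool (deg X a + card Y = deg X (f a))"])
        (auto simp: disjoint_family_on_def)
    also have "\<dots> \<le> (\<Prod>a\<in>A. 1 / sqrt (?N + 1))"
    proof (intro prod_mono conjI avg_nonneg)
      fix a assume a: "a \<in> A"
      \<comment> \<open>Only an inequality: if the target is below \<open>deg X a\<close>, the event
        is empty while the truncated difference is 0.\<close>
      have "avg (?B a) (\<lambda>Y. of_bool (deg X a + card Y = deg X (f a)))
          \<le> pr (?B a) (\<lambda>Y. card Y = deg X (f a) - deg X a)"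
        unfolding pr_def by (rule avg_mono) auto
      also have "\<dots> \<le> 1 / sqrt (card (?B a) + 1)"
        using binomial_prob_le[of "card (?B a)" "deg X (f a) - deg X a"] by (simp add: pr_card_eq add.commute)
      finally show "avg (?B a) (\<lambda>Y. of_bool (deg X a + card Y = deg X (f a))) \<le> 1 / sqrt (?N + 1)"
        using card_solo[of a T n r] a A T r by auto
    qed auto
    finally show "avg ?U (\<lambda>Y. of_bool (\<forall>a\<in>A. deg (X \<union> Y) a = deg (X \<union> Y) (f a)))
        \<le> (1 / sqrt (?N + 1)) ^ card A" by simp
  qed
  also have "\<dots> = (1 / sqrt (?N + 1)) ^ card A"
    by (rule avg_const) simp
  finally show ?thesis .
qed

text \<open>Complementing the part inside \<open>W\<close> turns the equation into one about the size of a random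
  subset of \<open>U \<union> W\<close>.\<close>

lemma avg_card_balance:
  assumes "finite U" "finite W" "U \<inter> W = {}"
  shows "avg (U \<union> W) (\<lambda>Y. of_bool (p + card (Y \<inter> U) = q + card (Y \<inter> W)))
    = pr (U \<union> W) (\<lambda>Y. card Y + p = q + card W)"
proof -
  let ?s = "\<lambda>Y. (Y \<inter> U) \<union> (W - Y)"
  have eq: "card (?s Y) = card (Y \<inter> U) + (card W - card (Y \<inter> W))" "card (Y \<inter> W) \<le> card W"
    if "Y \<subseteq> U \<union> W" for Y
  proof -
    have "card (?s Y) = card (Y \<inter> U) + card (W - Y)"
      using assms by (intro card_Un_disjoint) auto
    also have "card (W - Y) = card W - card (Y \<inter> W)"
      using card_Diff_subset_Int[of W Y] assms by (simp add: Int_commute)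
    finally show "card (?s Y) = card (Y \<inter> U) + (card W - card (Y \<inter> W))" .
    show "card (Y \<inter> W) \<le> card W" using assms by (intro card_mono) auto
  qed
  have "(\<Sum>Y\<in>Pow (U \<union> W). of_bool (p + card (Y \<inter> U) = q + card (Y \<inter> W)))
      = (\<Sum>Y\<in>Pow (U \<union> W). of_bool (card Y + p = q + card W) :: real)"
  proof (rule sum.reindex_bij_witness[where i = ?s and j = ?s])
    fix Y assume Y: "Y \<in> Pow (U \<union> W)"
    show "of_bool (card (?s Y) + p = q + card W) = (of_bool (p + card (Y \<inter> U) = q + card (Y \<inter> W)) :: real)"
      using eq[of Y] Y by (intro of_bool_eq_iff[THEN iffD2]) auto
  qed (use assms in auto)
  then show ?thesis by (simp add: pr_def avg_def)
qed

text \<open>After complementing, 2N fair bits have to hit a point at distance |p - q| from their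
  centre. The maximality of the central coefficient bounds this from above, flatness near the centre
  from below.\<close>

lemma pr_balance:
  assumes "finite U" "finite W" "U \<inter> W = {}" "card U = N" "card W = N" "0 < N"
  shows "avg (U \<union> W) (\<lambda>Y. of_bool (p + card (Y \<inter> U) = q + card (Y \<inter> W))) \<le> central N"
    and "central N * (1 - (real p - real q)\<^sup>2 / N)
      \<le> avg (U \<union> W) (\<lambda>Y. of_bool (p + card (Y \<inter> U) = q + card (Y \<inter> W)))"
proof -
  let ?P = "avg (U \<union> W) (\<lambda>Y. of_bool (p + card (Y \<inter> U) = q + card (Y \<inter> W)))"
  have card: "card (U \<union> W) = 2 * N" using assms by (simp add: card_Un_disjoint)
  have P: "?P = pr (U \<union> W) (\<lambda>Y. card Y + p = q + N)"
    using avg_card_balance[of U W p q] assms by simp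
  have le: "pr (U \<union> W) (\<lambda>Y. card Y = j) \<le> central N"
    and eq: "pr (U \<union> W) (\<lambda>Y. card Y = j) = (2 * N choose j) / 4 ^ N" for j
    using assms binomial_maximum'[of N j] card
    by (auto simp: pr_card_eq central_def power_mult intro!: divide_right_mono)
  have "?P \<le> pr (U \<union> W) (\<lambda>Y. card Y = q + N - p)"
    unfolding P by (rule pr_mono) auto
  with le show "?P \<le> central N" by (meson order_trans)
  show "central N * (1 - (real p - real q)\<^sup>2 / N) \<le> ?P"
  proof (cases "\<bar>real p - real q\<bar> \<le> N")
    case False
    \<comment> \<open>At a distance beyond N the claimed lower bound is not positive.\<close>
    then have "(real N)\<^sup>2 \<le> (real p - real q)\<^sup>2"
      by (metis abs_le_square_iff abs_of_nat linorder_le_cases)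
    moreover have "real N \<le> (real N)\<^sup>2"
      using assms(6) by (simp add: power2_eq_square)
    ultimately have "real N \<le> (real p - real q)\<^sup>2" by linarith
    then have "1 \<le> (real p - real q)\<^sup>2 / N"
      using assms(6) by (simp add: le_divide_eq)
    then have "central N * (1 - (real p - real q)\<^sup>2 / N) \<le> 0"
      using central_pos[of N] by (simp add: mult_le_0_iff)
    also have "0 \<le> ?P" by (rule avg_nonneg) simp
    finally show ?thesis .
  next
    case True
    \<comment> \<open>The distance from the centre; for p > q the symmetry of the binomial row moves
      the target to the upper half.\<close>
    define x where "x = (if p \<le> q then q - p else p - q)"
    have x: "x \<le> N" "(real x)\<^sup>2 = (real p - real q)\<^sup>2"
      using True by (auto simp: x_def of_nat_diff power2_commute)
    have "(2 * N choose (N + x)) = (2 * N choose (q + N - p))"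
    proof (cases "p \<le> q")
      case True then show ?thesis by (simp add: x_def add.commute)
    next
      case False
      then have "2 * N - (N + x) = q + N - p" using x(1) by (auto simp: x_def)
      then show ?thesis using binomial_symmetric[of "N + x" "2 * N"] x(1) by simp
    qed
    then have "central N * (1 - (real x)\<^sup>2 / N) \<le> pr (U \<union> W) (\<lambda>Y. card Y = q + N - p)"
      using binomial_near_centre[OF x(1)] unfolding eq central_def by (simp add: divide_right_mono)
    also have "\<dots> = ?P" unfolding P
      using x(1) by (intro pr_cong) (auto simp: x_def split: if_splits)
    finally show ?thesis using x by simp
  qed
qed

section \<open>Simultaneous coincidences along a matching\<close>

definition vertices :: "(nat \<times> nat) set \<Rightarrow> nat set" where
  "vertices Q = (\<Union>p\<in>Q. {fst p, snd p})"

definition matching :: "(nat \<times> nat) set \<Rightarrow> bool" where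
  "matching Q \<longleftrightarrow> (\<forall>p\<in>Q. fst p \<noteq> snd p) \<and>
     (\<forall>p\<in>Q. \<forall>q\<in>Q. p \<noteq> q \<longrightarrow> {fst p, snd p} \<inter> {fst q, snd q} = {})"

lemma card_vertices_matching:
  assumes "finite Q" "matching Q"
  shows "card (vertices Q) = 2 * card Q"
proof -
  have "card (vertices Q) = (\<Sum>p\<in>Q. card {fst p, snd p})"
    unfolding vertices_def using assms
    by (intro card_UN_disjoint) (auto simp: matching_def)
  also have "\<dots> = (\<Sum>p\<in>Q. 2)"
    using assms(2) by (intro sum.cong) (auto simp: matching_def)
  finally show ?thesis by simp
qed

text \<open>Weierstrass' product inequality. An \<open>x i\<close> above 1 is permitted, as happens
  when the exposed offset of a pair is large.\<close>

lemma prod_ge_one_minus_sum: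
  fixes x y :: "'a \<Rightarrow> real"
  assumes "finite I" "\<And>i. i \<in> I \<Longrightarrow> 0 \<le> y i" "\<And>i. i \<in> I \<Longrightarrow> y i \<le> 1" "\<And>i. i \<in> I \<Longrightarrow> 1 - x i \<le> y i"
  shows "1 - (\<Sum>i\<in>I. x i) \<le> (\<Prod>i\<in>I. y i)"
  using assms
proof (induction I rule: finite_induct)
  case (insert i I)
  have "(\<Prod>j\<in>I. y j) \<le> 1"
    using insert by (intro prod_le_1) auto
  then have "(1 - y i) * (\<Prod>j\<in>I. y j) \<le> (1 - y i) * 1"
    using insert by (intro mult_left_mono) auto
  moreover have "1 - (\<Sum>i\<in>I. x i) \<le> (\<Prod>i\<in>I. y i)" "1 - x i \<le> y i"
    using insert by auto
  ultimately show ?case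
    using insert.hyps by (simp add: algebra_simps)
qed simp

text \<open>Given the edges outside all solo blocks, the pairs are independent, and a pair with
  exposed offset d coincides with probability between \<open>central N\<close> times 1 - d^2/N and
  \<open>central N\<close>. The mean of d^2 is at most half the number of non-solo edges at a
  vertex, (n - 1 choose r - 1) - N, and summing over the pairs gives the relative error. For a fixed
  number of pairs this difference is of lower order than N.\<close>

lemma
  assumes Q: "finite Q" "matching Q" "vertices Q \<subseteq> {1..n}" and r: "1 \<le> r"
    and N: "N = (n - 2 * card Q) choose (r - 1)" "0 < N"
  shows pr_matching_le: "pr (edges r n) (\<lambda>E. \<forall>p\<in>Q. deg E (fst p) = deg E (snd p)) \<le> central N ^ card Q"
    and pr_matching_ge: "central N ^ card Q * (1 - card Q * (real ((n - 1) choose (r - 1)) - N) / (2 * N))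
      \<le> pr (edges r n) (\<lambda>E. \<forall>p\<in>Q. deg E (fst p) = deg E (snd p))" (is "?lower \<le> ?prob")
proof -
  define T where "T = vertices Q"
  let ?C = "(n - 1) choose (r - 1)"
  let ?s = "solo r n T"
  let ?B = "\<lambda>p. ?s (fst p) \<union> ?s (snd p)"
  let ?U = "\<Union>t\<in>T. ?s t"
  let ?R = "edges r n - ?U"
  let ?P = "\<lambda>X p. avg (?B p) (\<lambda>Y. of_bool (deg X (fst p) + card (Y \<inter> ?s (fst p)) = deg X (snd p) + card (Y \<inter> ?s (snd p))))"
  have T: "fst p \<in> T" "snd p \<in> T" "fst p \<noteq> snd p" if "p \<in> Q" for p
    using that Q(2) by (auto simp: T_def vertices_def matching_def)
  have Tn: "T \<subseteq> {1..n}" and finT: "finite T" using Q by (auto simp: T_def intro: finite_subset)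
  have cards: "card (?s t) = N" if "t \<in> T" for t
    using card_solo[OF that Tn r] N card_vertices_matching[OF Q(1,2)] by (simp add: T_def)
  have U: "?U \<subseteq> edges r n" using solo_subset by blast
  have U': "?U = (\<Union>p\<in>Q. ?B p)" by (auto simp: T_def vertices_def)
  have dis: "disjoint_family_on ?B Q"
    unfolding disjoint_family_on_def
  proof (intro ballI impI)
    fix p q assume pq: "p \<in> Q" "q \<in> Q" "p \<noteq> q"
    then have "{fst p, snd p} \<inter> {fst q, snd q} = {}" using Q(2) by (auto simp: matching_def)
    then show "?B p \<inter> ?B q = {}"
      using solo_disjoint[of "fst p" "fst q" r n T] solo_disjoint[of "fst p" "snd q" r n T]
        solo_disjoint[of "snd p" "fst q" r n T] solo_disjoint[of "snd p" "snd q" r n T] by auto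
  qed
  have "pr (edges r n) (\<lambda>E. \<forall>p\<in>Q. deg E (fst p) = deg E (snd p))
      = avg (?R \<union> ?U) (\<lambda>E. of_bool (\<forall>p\<in>Q. deg E (fst p) = deg E (snd p)))"
    using U by (simp add: pr_def Un_absorb2)
  also have "\<dots> = avg ?R (\<lambda>X. avg ?U (\<lambda>Y. of_bool (\<forall>p\<in>Q. deg (X \<union> Y) (fst p) = deg (X \<union> Y) (snd p))))"
    using U finT by (intro avg_Un) auto
  also have "\<dots> = avg ?R (\<lambda>X. \<Prod>p\<in>Q. ?P X p)"
  proof (rule avg_cong)
    fix X assume X: "X \<subseteq> ?R"
    have "avg ?U (\<lambda>Y. of_bool (\<forall>p\<in>Q. deg (X \<union> Y) (fst p) = deg (X \<union> Y) (snd p)))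
      = avg (\<Union>p\<in>Q. ?B p) (\<lambda>Y. \<Prod>p\<in>Q. of_bool (deg X (fst p) + card (Y \<inter> ?B p \<inter> ?s (fst p)) = deg X (snd p) + card (Y \<inter> ?B p \<inter> ?s (snd p))))"
      unfolding U'[symmetric]
    proof (rule avg_cong)
      fix Y assume Y: "Y \<subseteq> ?U"
      have "Y \<inter> ?B p \<inter> ?s (fst p) = Y \<inter> ?s (fst p)" "Y \<inter> ?B p \<inter> ?s (snd p) = Y \<inter> ?s (snd p)" for p
        by auto
      then show "of_bool (\<forall>p\<in>Q. deg (X \<union> Y) (fst p) = deg (X \<union> Y) (snd p))
        = (\<Prod>p\<in>Q. of_bool (deg X (fst p) + card (Y \<inter> ?B p \<inter> ?s (fst p)) = deg X (snd p) + card (Y \<inter> ?B p \<inter> ?s (snd p))) :: real)"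
        using deg_Un_solo(1)[OF subset_refl _ X Y] T Q(1) by (simp add: of_bool_ball_prod)
    qed
    also have "\<dots> = (\<Prod>p\<in>Q. ?P X p)"
      using Q(1) dis
      by (intro avg_prod_blocks[where g = "\<lambda>p Y. of_bool (deg X (fst p) + card (Y \<inter> ?s (fst p)) = deg X (snd p) + card (Y \<inter> ?s (snd p)))"])
        auto
    finally show "avg ?U (\<lambda>Y. of_bool (\<forall>p\<in>Q. deg (X \<union> Y) (fst p) = deg (X \<union> Y) (snd p))) = (\<Prod>p\<in>Q. ?P X p)" .
  qed
  finally have pr_eq: "pr (edges r n) (\<lambda>E. \<forall>p\<in>Q. deg E (fst p) = deg E (snd p)) = avg ?R (\<lambda>X. \<Prod>p\<in>Q. ?P X p)" .
  have nonneg: "0 \<le> ?P X p" for X p by (rule avg_nonneg) simp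
  have upper: "?P X p \<le> central N"
    and lower: "central N * (1 - (real (deg X (fst p)) - real (deg X (snd p)))\<^sup>2 / N) \<le> ?P X p" if "p \<in> Q" for X p
    using pr_balance[of "?s (fst p)" "?s (snd p)" N "deg X (fst p)" "deg X (snd p)"] T[OF that] cards N(2)
    by (auto simp: solo_disjoint)
  have "avg ?R (\<lambda>X. \<Prod>p\<in>Q. ?P X p) \<le> avg ?R (\<lambda>_. central N ^ card Q)"
  proof (rule avg_mono)
    fix X
    have "(\<Prod>p\<in>Q. ?P X p) \<le> (\<Prod>p\<in>Q. central N)"
      using upper nonneg by (intro prod_mono) auto
    then show "(\<Prod>p\<in>Q. ?P X p) \<le> central N ^ card Q" by simp
  qed
  then show "pr (edges r n) (\<lambda>E. \<forall>p\<in>Q. deg E (fst p) = deg E (snd p)) \<le> central N ^ card Q"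
    unfolding pr_eq by (simp add: avg_const)
  let ?d = "\<lambda>X p. real (deg X (fst p)) - real (deg X (snd p))"
  have degR: "real (deg ?R t) = real ?C - N" if "t \<in> T" for t
  proof -
    have "deg (?R \<union> ?U) t = deg ?R t + card (?U \<inter> ?s t)"
      by (rule deg_Un_solo(1)[OF subset_refl that]) auto
    moreover have "?R \<union> ?U = edges r n" using U by auto
    moreover have "?U \<inter> ?s t = ?s t" using that by auto
    ultimately show ?thesis using deg_edges[of t n r] that Tn r cards[OF that] by auto
  qed
  have second: "avg ?R (\<lambda>X. (?d X p)\<^sup>2) \<le> (real ?C - N) / 2" if p: "p \<in> Q" for p
  proof -
    let ?h = "\<lambda>e. of_bool (fst p \<in> e) - of_bool (snd p \<in> e) :: real"
    have deg_sum: "real (deg X v) = (\<Sum>e\<in>X. of_bool (v \<in> e))" if "finite X" for X v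
      using that by (simp add: deg_def of_bool_def sum.If_cases Int_def)
    have sum_h: "(\<Sum>e\<in>X. ?h e) = ?d X p" if "X \<subseteq> ?R" for X
      using deg_sum finite_subset[OF that] by (simp add: sum_subtractf)
    \<comment> \<open>Both vertices have equally many potential exposed edges, so the signed weights
      sum to 0 and the offset is already centred.\<close>
    have "avg ?R (\<lambda>X. (?d X p)\<^sup>2) = avg ?R (\<lambda>X. ((\<Sum>e\<in>X. ?h e) - (\<Sum>e\<in>?R. ?h e) / 2)\<^sup>2)"
      using sum_h degR[OF T(1)[OF p]] degR[OF T(2)[OF p]] by (intro avg_cong) simp
    also have "\<dots> = (\<Sum>e\<in>?R. (?h e)\<^sup>2) / 4"
      by (rule avg_centred_square) simp
    \<comment> \<open>Edges through both vertices cancel in \<open>?h\<close>, so the two exposed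
      degrees bound the sum of squares.\<close>
    also have "\<dots> \<le> (\<Sum>e\<in>?R. of_bool (fst p \<in> e) + of_bool (snd p \<in> e)) / 4"
      by (intro divide_right_mono sum_mono) auto
    also have "\<dots> = (real (deg ?R (fst p)) + real (deg ?R (snd p))) / 4"
      using deg_sum[of ?R] by (simp add: sum.distrib)
    finally show ?thesis using degR[OF T(1)[OF p]] degR[OF T(2)[OF p]] by simp
  qed
  have "central N ^ card Q * (1 - card Q * (real ?C - N) / (2 * N))
      = central N ^ card Q * (1 - (\<Sum>p\<in>Q. (real ?C - N) / 2 * (1 / N)))"
    by simp
  also have "\<dots> \<le> central N ^ card Q * (1 - (\<Sum>p\<in>Q. avg ?R (\<lambda>X. (?d X p)\<^sup>2) * (1 / N)))"
    using second central_pos[of N] by (intro mult_left_mono diff_left_mono sum_mono mult_right_mono) auto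
  also have "\<dots> = avg ?R (\<lambda>X. central N ^ card Q * (1 - (\<Sum>p\<in>Q. (?d X p)\<^sup>2 * (1 / N))))"
    by (simp only: avg_cmult avg_diff avg_sum avg_cmult_right avg_const finite_Diff finite_edges)
  also have "\<dots> \<le> avg ?R (\<lambda>X. \<Prod>p\<in>Q. ?P X p)"
  proof (rule avg_mono)
    fix X
    \<comment> \<open>Dividing by \<open>central N\<close> brings every factor into [0, 1], as the
      product inequality requires.\<close>
    have "1 - (\<Sum>p\<in>Q. (?d X p)\<^sup>2 * (1 / N)) \<le> (\<Prod>p\<in>Q. ?P X p / central N)"
      using Q(1) nonneg upper lower central_pos[of N]
      by (intro prod_ge_one_minus_sum) (auto simp: divide_simps mult.commute)
    then show "central N ^ card Q * (1 - (\<Sum>p\<in>Q. (?d X p)\<^sup>2 * (1 / N))) \<le> (\<Prod>p\<in>Q. ?P X p)"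
      using central_pos[of N] by (simp add: prod_dividef le_divide_eq mult.commute)
  qed
  finally show "?lower \<le> ?prob"
    by (simp only: pr_eq of_nat_mult of_nat_numeral)
qed

section \<open>Isolated pairs of equal degree\<close>

definition pairs :: "nat set \<Rightarrow> (nat \<times> nat) set" where
  "pairs W = {(u, v). u \<in> W \<and> v \<in> W \<and> u < v}"

definition matchings :: "nat \<Rightarrow> nat \<Rightarrow> (nat \<times> nat) set set" where
  "matchings m k = {Q. Q \<subseteq> pairs {1..m} \<and> matching Q \<and> card Q = k}"

definition isolated_collisions :: "nat \<Rightarrow> nat set set \<Rightarrow> (nat \<times> nat) set" where
  "isolated_collisions m E = {p\<in>pairs {1..m}. deg E (fst p) = deg E (snd p) \<and>
     (\<forall>w\<in>{1..m} - {fst p, snd p}. deg E w \<noteq> deg E (fst p))}"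

lemma finite_pairs [simp]: "finite W \<Longrightarrow> finite (pairs W)"
  by (rule finite_subset[of _ "W \<times> W"]) (auto simp: pairs_def)

lemma card_pairs:
  assumes "finite W"
  shows "card (pairs W) = card W choose 2"
proof -
  have "(\<lambda>(u, v). {u, v}) ` pairs W = {B. B \<subseteq> W \<and> card B = 2}"
  proof (intro equalityI subsetI)
    fix B assume "B \<in> {B. B \<subseteq> W \<and> card B = 2}"
    then obtain u v where "B = {u, v}" "u \<noteq> v" "u \<in> W" "v \<in> W" by (auto simp: card_2_iff)
    then have "(min u v, max u v) \<in> pairs W" "B = {min u v, max u v}"
      by (auto simp: pairs_def min_def max_def)
    then show "B \<in> (\<lambda>(u, v). {u, v}) ` pairs W" by force
  qed (auto simp: pairs_def)
  moreover have "inj_on (\<lambda>(u, v). {u, v}) (pairs W)"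
    by (auto simp: inj_on_def pairs_def doubleton_eq_iff)
  ultimately have "card (pairs W) = card {B. B \<subseteq> W \<and> card B = 2}"
    by (metis (no_types, lifting) card_image)
  then show ?thesis using n_subsets[OF assms] by simp
qed

lemma finite_matchings [simp]: "finite (matchings m k)"
  by (rule finite_subset[of _ "Pow (pairs {1..m})"]) (auto simp: matchings_def)

lemma matchingsD:
  assumes "Q \<in> matchings m k" "m \<le> n"
  shows "finite Q" "matching Q" "vertices Q \<subseteq> {1..n}" "card Q = k" "vertices Q \<subseteq> {1..m}"
proof -
  have Q: "Q \<subseteq> pairs {1..m}" "matching Q" "card Q = k" using assms(1) by (auto simp: matchings_def)
  then show "finite Q" "matching Q" "card Q = k" by (auto intro: finite_subset)
  show "vertices Q \<subseteq> {1..n}" "vertices Q \<subseteq> {1..m}"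
    using Q(1) assms(2) by (fastforce simp: vertices_def pairs_def)+
qed

lemma card_matchings_le: "fact k * card (matchings m k) \<le> (m choose 2) ^ k"
proof -
  have "card (matchings m k) \<le> card {Q. Q \<subseteq> pairs {1..m} \<and> card Q = k}"
  proof (rule card_mono)
    show "finite {Q. Q \<subseteq> pairs {1..m} \<and> card Q = k}"
      by (rule finite_subset[of _ "Pow (pairs {1..m})"]) auto
  qed (auto simp: matchings_def)
  also have "\<dots> = (m choose 2) choose k"
    by (simp add: n_subsets card_pairs)
  finally have "fact k * card (matchings m k) \<le> fact k * ((m choose 2) choose k)" by simp
  also have "\<dots> \<le> (m choose 2) ^ k"
    using binomial_fact_pow[of "m choose 2" k] by (simp add: mult.commute)
  finally show ?thesis .
qed

text \<open>Double counting of pairs of a matching with \<open>k + 1\<close> edges and one of its edges.\<close>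

lemma card_matchings_Suc: "((m - 2 * k) choose 2) * card (matchings m k) \<le> Suc k * card (matchings m (Suc k))"
proof -
  let ?ext = "\<lambda>Q. pairs ({1..m} - vertices Q)"
  let ?S = "Sigma (matchings m k) ?ext"
  let ?S' = "Sigma (matchings m (Suc k)) (\<lambda>Q. Q)"
  have "card (?ext Q) = (m - 2 * k) choose 2" if "Q \<in> matchings m k" for Q
    using matchingsD[OF that order_refl] card_vertices_matching[of Q]
    by (subst card_pairs) (simp_all add: card_Diff_subset finite_subset)
  then have "((m - 2 * k) choose 2) * card (matchings m k) = card ?S"
    by simp
  also have "\<dots> \<le> card ?S'"
  proof (rule card_inj_on_le)
    have new: "p \<notin> Q" if "p \<in> ?ext Q" for p Q
      using that by (auto simp: pairs_def vertices_def)
    show "inj_on (\<lambda>(Q, p). (insert p Q, p)) ?S"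
    proof (rule inj_onI)
      fix x y assume xy: "x \<in> ?S" "y \<in> ?S" and eq: "(\<lambda>(Q, p). (insert p Q, p)) x = (\<lambda>(Q, p). (insert p Q, p)) y"
      obtain Q p Q' p' where defs: "x = (Q, p)" "y = (Q', p')" by (cases x, cases y) blast
      then have "p \<notin> Q" "p' \<notin> Q'" using xy new by blast+
      moreover have "insert p Q = insert p' Q'" "p = p'" using eq defs by auto
      ultimately show "x = y" using defs by (metis insert_ident)
    qed
    show "(\<lambda>(Q, p). (insert p Q, p)) ` ?S \<subseteq> ?S'"
    proof clarify
      fix Q u v assume Q: "Q \<in> matchings m k" and p: "(u, v) \<in> ?ext Q"
      have "{u, v} \<inter> {fst q, snd q} = {}" if "q \<in> Q" for q
        using p that by (auto simp: pairs_def vertices_def)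
      then have "matching (insert (u, v) Q)"
        using p matchingsD(2)[OF Q order_refl] by (auto simp: matching_def pairs_def)
      then show "insert (u, v) Q \<in> matchings m (Suc k) \<and> (u, v) \<in> insert (u, v) Q"
        using Q p new[OF p] matchingsD(1)[OF Q order_refl] by (auto simp: matchings_def pairs_def)
    qed
    show "finite ?S'"
      using matchingsD(1) by (intro finite_SigmaI) auto
  qed
  also have "card ?S' = Suc k * card (matchings m (Suc k))"
    using matchingsD(1) by (subst card_SigmaI) (auto simp: matchings_def)
  finally show ?thesis .
qed

text \<open>The extension count is iterated with its smallest factor, the one for j = k, at every
  stage. The result is a pure power with the same leading order in m as the upper bound.\<close>

lemma card_matchings_ge: "((m - 2 * k) choose 2) ^ k \<le> fact k * card (matchings m k)"
proof -
  have "((m - 2 * k) choose 2) ^ j \<le> fact j * card (matchings m j)" if "j \<le> k" for j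
    using that
  proof (induction j)
    case 0
    have "Q = {}" if "Q \<in> matchings m 0" for Q
      using matchingsD(1,4)[OF that order_refl] by simp
    moreover have "{} \<in> matchings m 0"
      by (simp add: matchings_def matching_def)
    ultimately have "matchings m 0 = {{}}" by blast
    then show ?case by simp
  next
    case (Suc j)
    have "((m - 2 * k) choose 2) ^ Suc j \<le> ((m - 2 * j) choose 2) * (fact j * card (matchings m j))"
      using Suc unfolding power_Suc by (intro mult_mono binomial_right_mono) auto
    also have "\<dots> \<le> fact j * (Suc j * card (matchings m (Suc j)))"
      using card_matchings_Suc[of m j] by (simp add: mult.left_commute)
    finally show ?case by (simp add: algebra_simps)
  qed
  then show ?thesis by blast
qed

section \<open>Moments of the number of isolated collisions\<close>

lemma finite_isolated_collisions [simp]: "finite (isolated_collisions m E)"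
  by (simp add: isolated_collisions_def)

text \<open>Isolated collisions that share a vertex have the same degree, and only two vertices of
  the window have it. As pairs are ordered increasingly, the collisions are equal.\<close>

lemma subset_isolated_collisions:
  "{Q. Q \<subseteq> isolated_collisions m E \<and> card Q = k} = {Q\<in>matchings m k. Q \<subseteq> isolated_collisions m E}"
proof -
  have "matching Q" if "Q \<subseteq> isolated_collisions m E" for Q
    unfolding matching_def
  proof (intro conjI ballI impI)
    fix p assume "p \<in> Q"
    then show "fst p \<noteq> snd p" using that by (auto simp: isolated_collisions_def pairs_def)
  next
    fix p q assume pq: "p \<in> Q" "q \<in> Q" "p \<noteq> q"
    then have p: "p \<in> isolated_collisions m E" and q: "q \<in> isolated_collisions m E" using that by auto
    show "{fst p, snd p} \<inter> {fst q, snd q} = {}"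
    proof (rule ccontr)
      assume "{fst p, snd p} \<inter> {fst q, snd q} \<noteq> {}"
      then have "deg E (fst p) = deg E (fst q)"
        using p q by (auto simp: isolated_collisions_def)
      moreover have "w \<in> {fst p, snd p}" if "w \<in> {1..m}" "deg E w = deg E (fst p)" for w
        using p that by (auto simp: isolated_collisions_def)
      moreover have "fst q \<in> {1..m}" "snd q \<in> {1..m}" "deg E (snd q) = deg E (fst q)" "fst q < snd q" "fst p < snd p"
        using p q by (auto simp: isolated_collisions_def pairs_def)
      ultimately have "fst q \<in> {fst p, snd p}" "snd q \<in> {fst p, snd p}" "fst q < snd q" "fst p < snd p"
        by metis+
      then show False
        using pq(3) by (auto simp: prod_eq_iff)
    qed
  qed
  then show ?thesis by (auto simp: matchings_def isolated_collisions_def)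
qed

text \<open>Linearity of expectation: the binomial coefficient counts k-subsets of collisions, and
  all of these are matchings.\<close>

lemma avg_choose_isolated:
  "avg S (\<lambda>E. real (card (isolated_collisions m E) choose k))
    = (\<Sum>Q\<in>matchings m k. pr S (\<lambda>E. Q \<subseteq> isolated_collisions m E))"
proof -
  have eq: "real (card (isolated_collisions m E) choose k)
      = (\<Sum>Q\<in>matchings m k. of_bool (Q \<subseteq> isolated_collisions m E))" for E
  proof -
    have "card (isolated_collisions m E) choose k = card {Q\<in>matchings m k. Q \<subseteq> isolated_collisions m E}"
      unfolding subset_isolated_collisions[symmetric] by (simp add: n_subsets)
    then show ?thesis by (simp add: of_bool_def sum.If_cases Int_def)
  qed
  show ?thesis unfolding eq pr_def by (rule avg_sum)
qed

text \<open>A further coincidence is a further independent equation and gains one more factor of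
  order N^(-1/2). The equations have to be oriented so that k + 1 distinct vertices get targets
  outside their own set, where k = \<open>card Q\<close>.\<close>

lemma pr_matching_third_le:
  assumes Q: "finite Q" "matching Q" "vertices Q \<subseteq> {1..n}" and p: "p \<in> Q"
    and w: "w \<in> {1..n} - {fst p, snd p}" and r: "1 \<le> r"
  shows "pr (edges r n) (\<lambda>E. (\<forall>q\<in>Q. deg E (fst q) = deg E (snd q)) \<and> deg E w = deg E (fst p))
    \<le> (1 / sqrt (((n - (2 * card Q + 1)) choose (r - 1)) + 1)) ^ (card Q + 1)"
proof -
  \<comment> \<open>The partner of a first component.\<close>
  let ?g = "\<lambda>a. snd (inv_into Q fst a)"
  have inj: "inj_on fst Q"
    using Q(2) by (auto simp: inj_on_def matching_def)
  have g: "?g (fst q) = snd q" if "q \<in> Q" for q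
    using inj that by simp
  have snd: "snd q \<notin> fst ` Q" if "q \<in> Q" for q
  proof
    assume "snd q \<in> fst ` Q"
    then obtain q' where "q' \<in> Q" "snd q = fst q'" by auto
    then show False using Q(2) that by (cases "q = q'") (auto simp: matching_def)
  qed
  \<comment> \<open>The two cases involve 2k + 1 or 2k vertices; both are brought to the weaker
    bound.\<close>
  have le: "(1 / sqrt (((n - c) choose (r - 1)) + 1)) ^ (card Q + 1)
      \<le> (1 / sqrt (((n - (2 * card Q + 1)) choose (r - 1)) + 1)) ^ (card Q + 1)"
    if "c \<le> 2 * card Q + 1" for c
    using that
    by (intro power_mono divide_left_mono real_sqrt_le_mono add_mono of_nat_mono binomial_right_mono mult_pos_pos)
      (auto intro: add_nonneg_pos)
  show ?thesis
  proof (cases "w \<in> vertices Q")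
    case False
    \<comment> \<open>A vertex outside the matching joins the first components, with
      \<open>snd p\<close> as its target.\<close>
    let ?A = "insert w (fst ` Q)" and ?T = "insert w (vertices Q)"
    let ?f = "\<lambda>a. if a = w then snd p else ?g a"
    have notin: "w \<notin> fst ` Q" "\<And>q. q \<in> Q \<Longrightarrow> snd q \<noteq> w" "\<And>q. q \<in> Q \<Longrightarrow> fst q \<noteq> w"
      using False by (auto simp: vertices_def)
    have "pr (edges r n) (\<lambda>E. (\<forall>q\<in>Q. deg E (fst q) = deg E (snd q)) \<and> deg E w = deg E (fst p))
        \<le> pr (edges r n) (\<lambda>E. \<forall>a\<in>?A. deg E a = deg E (?f a))"
      using p g notin by (intro pr_mono) auto
    also have "\<dots> \<le> (1 / sqrt (((n - card ?T) choose (r - 1)) + 1)) ^ card ?A"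
    proof (intro pr_degrees_eq_le r)
      show "?T \<subseteq> {1..n}" using Q w by auto
      show "?A \<subseteq> ?T" by (auto simp: vertices_def)
      fix a assume a: "a \<in> ?A"
      show "?f a \<in> ?T - ?A"
      proof (cases "a = w")
        case True
        then show ?thesis using p snd[OF p] notin(2)[OF p] by (auto simp: vertices_def)
      next
        case False
        with a obtain q where q: "q \<in> Q" "a = fst q" by auto
        then show ?thesis
          using False snd[OF q(1)] g[OF q(1)] notin(2)[OF q(1)] by (auto simp: vertices_def)
      qed
    qed
    also have "card ?A = card Q + 1"
      using Q(1) notin inj by (simp add: card_image)
    finally show ?thesis
      using le[of "card ?T"] False Q card_vertices_matching[OF Q(1,2)] finite_subset[OF Q(3)] by auto
  next
    case True
    then obtain q where q: "q \<in> Q" "w \<in> {fst q, snd q}" by (auto simp: vertices_def)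
    \<comment> \<open>If \<open>w\<close> belongs to another pair \<open>q\<close>, the degree
      classes of \<open>p\<close> and \<open>q\<close> merge. Both vertices of \<open>q\<close> now
      aim at \<open>snd p\<close>, which still makes k + 1 equations.\<close>
    let ?A = "insert (snd q) (fst ` Q)" and ?T = "vertices Q"
    let ?f = "\<lambda>a. if a = snd q \<or> a = fst q then snd p else ?g a"
    have pq: "p \<noteq> q" using q w by auto
    then have ne: "snd p \<noteq> snd q" using Q(2) p q(1) by (auto simp: matching_def)
    have "pr (edges r n) (\<lambda>E. (\<forall>q\<in>Q. deg E (fst q) = deg E (snd q)) \<and> deg E w = deg E (fst p))
        \<le> pr (edges r n) (\<lambda>E. \<forall>a\<in>?A. deg E a = deg E (?f a))"
    proof (rule pr_mono)
      fix E assume E: "(\<forall>q\<in>Q. deg E (fst q) = deg E (snd q)) \<and> deg E w = deg E (fst p)"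
      then have "deg E (fst q) = deg E (snd p)" "deg E (snd q) = deg E (snd p)"
        using p q by auto
      then show "\<forall>a\<in>?A. deg E a = deg E (?f a)" using E g by auto
    qed
    also have "\<dots> \<le> (1 / sqrt (((n - card ?T) choose (r - 1)) + 1)) ^ card ?A"
    proof (intro pr_degrees_eq_le r Q(3))
      show "?A \<subseteq> ?T" using q by (auto simp: vertices_def)
      fix a assume "a \<in> ?A"
      then show "?f a \<in> ?T - ?A"
      proof (cases "a = snd q \<or> a = fst q")
        case True
        then show ?thesis using p snd ne by (auto simp: vertices_def)
      next
        case False
        with \<open>a \<in> ?A\<close> obtain q' where q': "q' \<in> Q" "a = fst q'" "q' \<noteq> q" by auto
        then have "snd q' \<noteq> snd q" using Q(2) q(1) by (auto simp: matching_def)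
        then show ?thesis using q' False snd g by (auto simp: vertices_def)
      qed
    qed
    also have "card ?A = card Q + 1"
      using Q(1) snd[OF q(1)] inj by (simp add: card_image)
    finally show ?thesis
      using le[of "card ?T"] card_vertices_matching[OF Q(1,2)] by auto
  qed
qed

text \<open>A coinciding matching fails to be isolated only if a further vertex of the window joins
  the class of one of its pairs: a union bound over k pairs and at most m vertices.\<close>

lemma pr_isolated_ge:
  assumes Q: "Q \<in> matchings m k" and m: "m \<le> n" and r: "1 \<le> r"
  shows "pr (edges r n) (\<lambda>E. \<forall>p\<in>Q. deg E (fst p) = deg E (snd p))
      - k * m * (1 / sqrt (((n - (2 * k + 1)) choose (r - 1)) + 1)) ^ (k + 1)
    \<le> pr (edges r n) (\<lambda>E. Q \<subseteq> isolated_collisions m E)"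
proof -
  note D = matchingsD[OF Q m]
  let ?s = "1 / sqrt (((n - (2 * k + 1)) choose (r - 1)) + 1)"
  let ?coll = "\<lambda>E. \<forall>q\<in>Q. deg E (fst q) = deg E (snd q)"
  let ?third = "\<lambda>p E. \<exists>w\<in>{1..m} - {fst p, snd p}. ?coll E \<and> deg E w = deg E (fst p)"
  have "pr (edges r n) ?coll
      \<le> pr (edges r n) (\<lambda>E. Q \<subseteq> isolated_collisions m E \<or> (\<exists>p\<in>Q. ?third p E))"
  proof (rule pr_mono)
    fix E assume coll: "?coll E"
    show "Q \<subseteq> isolated_collisions m E \<or> (\<exists>p\<in>Q. ?third p E)"
    proof (rule disjCI)
      assume not_third: "\<not> (\<exists>p\<in>Q. ?third p E)"
      show "Q \<subseteq> isolated_collisions m E"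
      proof
        fix p assume p: "p \<in> Q"
        then have "p \<in> pairs {1..m}" using Q by (auto simp: matchings_def)
        moreover have "deg E w \<noteq> deg E (fst p)" if "w \<in> {1..m} - {fst p, snd p}" for w
          using not_third coll p that by blast
        ultimately show "p \<in> isolated_collisions m E"
          using coll p by (simp add: isolated_collisions_def)
      qed
    qed
  qed
  also have "\<dots> \<le> pr (edges r n) (\<lambda>E. Q \<subseteq> isolated_collisions m E) + pr (edges r n) (\<lambda>E. \<exists>p\<in>Q. ?third p E)"
    by (rule pr_or_le)
  also have "pr (edges r n) (\<lambda>E. \<exists>p\<in>Q. ?third p E) \<le> card Q * (m * ?s ^ (k + 1))"
  proof (rule pr_bex_le_const)
    show "finite Q" by (rule D(1))
    fix p assume p: "p \<in> Q"
    have "pr (edges r n) (?third p) \<le> card ({1..m} - {fst p, snd p}) * ?s ^ (k + 1)"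
      using pr_matching_third_le[OF D(1,2,3) p _ r] m unfolding D(4)
      by (intro pr_bex_le_const) auto
    also have "\<dots> \<le> m * ?s ^ (k + 1)"
      using card_mono[of "{1..m}" "{1..m} - {fst p, snd p}"]
      by (intro mult_right_mono) auto
    finally show "pr (edges r n) (?third p) \<le> m * ?s ^ (k + 1)" .
  qed
  finally show ?thesis using D(4) by (simp add: algebra_simps)
qed

lemma pr_isolated_le:
  assumes Q: "Q \<in> matchings m k" and m: "m \<le> n" and r: "1 \<le> r" and N: "0 < (n - 2 * k) choose (r - 1)"
  shows "pr (edges r n) (\<lambda>E. Q \<subseteq> isolated_collisions m E) \<le> central ((n - 2 * k) choose (r - 1)) ^ k"
proof -
  note D = matchingsD[OF Q m]
  have "pr (edges r n) (\<lambda>E. Q \<subseteq> isolated_collisions m E)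
      \<le> pr (edges r n) (\<lambda>E. \<forall>p\<in>Q. deg E (fst p) = deg E (snd p))"
    by (rule pr_mono) (auto simp: isolated_collisions_def)
  also have "\<dots> \<le> central ((n - 2 * k) choose (r - 1)) ^ k"
    using pr_matching_le[OF D(1-3) r] D(4) N by simp
  finally show ?thesis .
qed

text \<open>For x > 0 the truncated alternating sum collapses to (-1)^m (x - 1 choose m). The error
  is thus at most the last term kept, so after averaging it is itself one of the moments.\<close>

lemma bonferroni:
  "\<bar>of_bool (x = 0) - (\<Sum>j\<le>m. (-1) ^ j * real (x choose j))\<bar> \<le> real (x choose m)"
proof (cases x)
  case 0
  have "(\<Sum>j\<le>m. (-1) ^ j * real (0 choose j)) = 1" by (induction m) auto
  then show ?thesis using 0 by simp
next
  case (Suc y)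
  have "(\<Sum>j\<le>m. (-1) ^ j * real (Suc y choose j)) = (-1) ^ m * real (y choose m)"
    by (induction m) (auto simp: algebra_simps)
  moreover have "y choose m \<le> Suc y choose m" by (rule binomial_right_mono) simp
  ultimately show ?thesis using Suc by (simp add: abs_mult)
qed

lemma pr_no_isolated:
  "\<bar>pr S (\<lambda>E. isolated_collisions m E = {})
      - (\<Sum>j\<le>k. (-1) ^ j * avg S (\<lambda>E. real (card (isolated_collisions m E) choose j)))\<bar>
    \<le> avg S (\<lambda>E. real (card (isolated_collisions m E) choose k))"
proof -
  let ?x = "\<lambda>E. card (isolated_collisions m E)"
  let ?b = "\<lambda>E. of_bool (?x E = 0) - (\<Sum>j\<le>k. (-1) ^ j * real (?x E choose j))"
  have eq: "pr S (\<lambda>E. isolated_collisions m E = {})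
      - (\<Sum>j\<le>k. (-1) ^ j * avg S (\<lambda>E. real (?x E choose j))) = avg S ?b"
    by (simp add: pr_def avg_diff avg_sum avg_cmult)
  have "avg S ?b \<le> avg S (\<lambda>E. real (?x E choose k))"
  proof (rule avg_mono)
    fix E
    show "?b E \<le> real (?x E choose k)"
      using abs_le_D1[OF bonferroni[of "?x E" k]] .
  qed
  moreover have "avg S (\<lambda>E. - 1 * real (?x E choose k)) \<le> avg S ?b"
  proof (rule avg_mono)
    fix E
    show "- 1 * real (?x E choose k) \<le> ?b E"
      using abs_le_D2[OF bonferroni[of "?x E" k]] by linarith
  qed
  ultimately show ?thesis unfolding eq by (simp only: avg_cmult)
qed

text \<open>A collision that is not isolated makes three degrees agree. This is two independent
  equations, hence has probability O(1/N) for each triple.\<close>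

lemma pr_triple_le:
  assumes "m \<le> n" "1 \<le> r"
  shows "pr (edges r n) (\<lambda>E. isolated_collisions m E = {})
    \<le> pr (edges r n) (\<lambda>E. inj_on (deg E) {1..m}) + m ^ 3 * (1 / sqrt (((n - 3) choose (r - 1)) + 1))\<^sup>2"
    (is "?lhs \<le> ?rhs")
    and "pr (edges r n) (\<lambda>E. inj_on (deg E) {1..m}) \<le> pr (edges r n) (\<lambda>E. isolated_collisions m E = {})"
proof -
  let ?I = "{(u, v, w). u \<in> {1..m} \<and> v \<in> {1..m} \<and> w \<in> {1..m} \<and> u \<noteq> v \<and> w \<noteq> u \<and> w \<noteq> v}"
  \<comment> \<open>The two vertices \<open>u\<close> and \<open>v\<close> both aim at the fixed
    degree of \<open>w\<close>.\<close>
  let ?P = "\<lambda>(u, v, w) E. \<forall>a\<in>{u, v}. deg E a = deg E w"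
  let ?s = "1 / sqrt (((n - 3) choose (r - 1)) + 1)"
  have sub: "?I \<subseteq> {1..m} \<times> {1..m} \<times> {1..m}" by auto
  have "pr (edges r n) (\<lambda>E. isolated_collisions m E = {})
    \<le> pr (edges r n) (\<lambda>E. inj_on (deg E) {1..m} \<or> (\<exists>i\<in>?I. ?P i E))"
  proof (rule pr_mono)
    fix E assume E: "isolated_collisions m E = {}"
    show "inj_on (deg E) {1..m} \<or> (\<exists>i\<in>?I. ?P i E)"
    proof (cases "inj_on (deg E) {1..m}")
      case False
      then obtain u v where uv: "u \<in> {1..m}" "v \<in> {1..m}" "deg E u = deg E v" "u < v"
        unfolding inj_on_def by (metis linorder_neqE_nat)
      then have "(u, v) \<notin> isolated_collisions m E" "(u, v) \<in> pairs {1..m}"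
        using E by (auto simp: pairs_def)
      then have "\<not> (\<forall>w\<in>{1..m} - {u, v}. deg E w \<noteq> deg E u)"
        using uv by (auto simp: isolated_collisions_def)
      then obtain w where "w \<in> {1..m} - {u, v}" "deg E w = deg E u"
        by blast
      then have "(u, v, w) \<in> ?I" "?P (u, v, w) E" using uv by auto
      then show ?thesis by blast
    qed simp
  qed
  also have "\<dots> \<le> pr (edges r n) (\<lambda>E. inj_on (deg E) {1..m}) + pr (edges r n) (\<lambda>E. \<exists>i\<in>?I. ?P i E)"
    by (rule pr_or_le)
  also have "pr (edges r n) (\<lambda>E. \<exists>i\<in>?I. ?P i E) \<le> card ?I * ?s\<^sup>2"
  proof (rule pr_bex_le_const)
    show "finite ?I" using sub by (rule finite_subset) simp
    fix i assume "i \<in> ?I"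
    then obtain u v w where i: "i = (u, v, w)" "u \<in> {1..m}" "v \<in> {1..m}" "w \<in> {1..m}" "u \<noteq> v" "w \<noteq> u" "w \<noteq> v"
      by auto
    then have c: "card {u, v, w} = 3" "card {u, v} = 2" by auto
    have "pr (edges r n) (\<lambda>E. \<forall>a\<in>{u, v}. deg E a = deg E w)
        \<le> (1 / sqrt (((n - card {u, v, w}) choose (r - 1)) + 1)) ^ card {u, v}"
      using i assms by (intro pr_degrees_eq_le) auto
    then show "pr (edges r n) (?P i) \<le> ?s\<^sup>2" unfolding c i by simp
  qed
  also have "card ?I * ?s\<^sup>2 \<le> m ^ 3 * ?s\<^sup>2"
  proof (intro mult_right_mono of_nat_mono)
    have "card ?I \<le> card ({1..m} \<times> {1..m} \<times> {1..m})" by (rule card_mono[OF _ sub]) simp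
    then show "card ?I \<le> m ^ 3" by (simp add: power3_eq_cube)
  qed simp
  finally show "?lhs \<le> ?rhs" by (simp only: of_nat_power)
  show "pr (edges r n) (\<lambda>E. inj_on (deg E) {1..m}) \<le> pr (edges r n) (\<lambda>E. isolated_collisions m E = {})"
  proof (rule pr_mono)
    fix E assume inj: "inj_on (deg E) {1..m}"
    have False if "p \<in> isolated_collisions m E" for p
      using inj_onD[OF inj, of "fst p" "snd p"] that
      by (auto simp: isolated_collisions_def pairs_def)
    then show "isolated_collisions m E = {}" by blast
  qed
qed

section \<open>Poisson limit\<close>

lemma tendsto_choose_over_power: "(\<lambda>n. real ((n - c) choose s) / real n ^ s) \<longlonglongrightarrow> 1 / fact s"
proof (induction s)
  case (Suc s)
  have "(\<lambda>n. (real n - c - s) / n) \<longlonglongrightarrow> 1" by real_asymp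
  with Suc.IH have "(\<lambda>n. real ((n - c) choose s) / real n ^ s * ((real n - c - s) / n) / Suc s) \<longlonglongrightarrow> 1 / fact s * 1 / Suc s"
    by (intro tendsto_divide[OF tendsto_mult tendsto_const]) auto
  moreover have "\<forall>\<^sub>F n in sequentially. real ((n - c) choose s) / real n ^ s * ((real n - c - s) / n) / Suc s
      = real ((n - c) choose Suc s) / real n ^ Suc s"
    using eventually_ge_at_top[of "c + s + 1"]
  proof eventually_elim
    case (elim n)
    have "Suc s * ((n - c) choose Suc s) = ((n - c) - s) * ((n - c) choose s)"
      by (metis binomial_absorb_comp binomial_absorption)
    then have "real (Suc s) * real ((n - c) choose Suc s) = (real n - c - s) * real ((n - c) choose s)"
      using elim by (metis (no_types, lifting) add_leD1 diff_diff_left of_nat_add of_nat_diff of_nat_mult diff_diff_eq)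
    then have "real ((n - c) choose Suc s) = (real n - c - s) * real ((n - c) choose s) / Suc s"
      by (simp add: field_simps)
    then show ?case by (simp add: ac_simps)
  qed
  ultimately have "(\<lambda>n. real ((n - c) choose Suc s) / real n ^ Suc s) \<longlonglongrightarrow> 1 / fact s * 1 / Suc s"
    by (rule Lim_transform_eventually)
  then show ?case by (simp add: mult.commute)
qed simp

lemma choose_at_top:
  assumes "1 \<le> s"
  shows "filterlim (\<lambda>n. (n - c) choose s) at_top sequentially"
proof -
  have "filterlim (\<lambda>n. real n ^ s) at_top sequentially"
    using assms by (intro filterlim_pow_at_top filterlim_real_sequentially) auto
  with tendsto_choose_over_power[of c s]
  have "filterlim (\<lambda>n. real ((n - c) choose s) / real n ^ s * real n ^ s) at_top sequentially"
    by (intro filterlim_tendsto_pos_mult_at_top[where c = "1 / fact s"]) auto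
  moreover have "\<forall>\<^sub>F n in sequentially. real ((n - c) choose s) / real n ^ s * real n ^ s = real ((n - c) choose s)"
    using eventually_gt_at_top[of 0] by eventually_elim simp
  ultimately have "filterlim (\<lambda>n. real ((n - c) choose s)) at_top sequentially"
    by (simp add: filterlim_cong)
  then show ?thesis by (simp add: filterlim_sequentially_iff_filterlim_real)
qed

text \<open>The truncation is chosen before n: k makes the tail of the series of exp(-l) and its
  k-th term small, and then finitely many moments are close to their limits. Convergence of each
  single moment therefore suffices.\<close>

lemma poisson_limit:
  fixes p :: "nat \<Rightarrow> real" and \<mu> :: "nat \<Rightarrow> nat \<Rightarrow> real"
  assumes lim: "\<And>j. \<mu> j \<longlonglongrightarrow> l ^ j / fact j"
    and bound: "\<And>k n. \<bar>p n - (\<Sum>j\<le>k. (-1) ^ j * \<mu> j n)\<bar> \<le> \<mu> k n"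
  shows "p \<longlonglongrightarrow> exp (- l)"
proof (rule LIMSEQ_I)
  fix e :: real assume e: "0 < e"
  let ?S = "\<lambda>k. \<Sum>j\<le>k. (-1) ^ j * (l ^ j / fact j)"
  have "(\<lambda>j. inverse (fact j) * (-l) ^ j) sums exp (-l)"
    using exp_converges[of "-l"] by (simp add: divide_inverse)
  moreover have "inverse (fact j) * (-l) ^ j = (-1) ^ j * (l ^ j / fact j)" for j
    by (simp add: divide_inverse power_minus[of l j])
  ultimately have "?S \<longlonglongrightarrow> exp (-l)"
    by (simp add: sums_def_le)
  then have "\<forall>\<^sub>F k in sequentially. \<bar>?S k - exp (-l)\<bar> < e / 4"
    using e by (auto dest!: tendstoD[of _ _ _ "e / 4"] simp: dist_real_def)
  moreover have "(\<lambda>k. l ^ k / fact k) \<longlonglongrightarrow> 0"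
    using summable_LIMSEQ_zero[OF summable_exp[of l]] by (simp add: divide_inverse mult.commute)
  then have "\<forall>\<^sub>F k in sequentially. \<bar>l ^ k / fact k\<bar> < e / 4"
    using e by (auto dest!: tendstoD[of _ _ _ "e / 4"] simp: dist_real_def)
  ultimately have "\<forall>\<^sub>F k in sequentially. \<bar>?S k - exp (-l)\<bar> < e / 4 \<and> \<bar>l ^ k / fact k\<bar> < e / 4"
    by (rule eventually_conj)
  then obtain k where k: "\<bar>?S k - exp (-l)\<bar> < e / 4" "\<bar>l ^ k / fact k\<bar> < e / 4"
    by (auto simp: eventually_sequentially)
  have "(\<lambda>n. \<Sum>j\<le>k. (-1) ^ j * \<mu> j n) \<longlonglongrightarrow> ?S k"
    by (intro tendsto_sum tendsto_mult tendsto_const lim)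
  then have "\<forall>\<^sub>F n in sequentially. \<bar>(\<Sum>j\<le>k. (-1) ^ j * \<mu> j n) - ?S k\<bar> < e / 4"
    using e by (auto dest!: tendstoD[of _ _ _ "e / 4"] simp: dist_real_def)
  moreover have "\<forall>\<^sub>F n in sequentially. \<bar>\<mu> k n - l ^ k / fact k\<bar> < e / 4"
    using e tendstoD[OF lim[of k], of "e / 4"] by (simp add: dist_real_def)
  \<comment> \<open>Four errors of e/4: the two halves of the bound on the k-th moment, the
    convergence of the truncated sum, and the tail of the series.\<close>
  ultimately have "\<forall>\<^sub>F n in sequentially. norm (p n - exp (-l)) < e"
  proof eventually_elim
    case (elim n)
    then show ?case using bound[of n k] k by (simp only: real_norm_def)
  qed
  then show "\<exists>N. \<forall>n\<ge>N. norm (p n - exp (- l)) < e"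
    by (simp add: eventually_sequentially)
qed

text \<open>The critical scale, at which the expected number of collisions stays bounded. It is
  shared by the full vertex set for r = 5 and by sublinear windows for r = 3 and r = 4.\<close>

locale collision_window =
  fixes r :: nat and m :: "nat \<Rightarrow> nat" and \<mu> :: real
  assumes r: "2 \<le> r" and m_le: "m n \<le> n"
    and m_top: "filterlim m at_top sequentially"
    and m_asymp: "(\<lambda>n. (real (m n))\<^sup>2 / sqrt (real n ^ (r - 1))) \<longlonglongrightarrow> \<mu>"
begin

lemma m_real_top: "filterlim (\<lambda>n. real (m n)) at_top sequentially"
  using m_top by (simp add: filterlim_sequentially_iff_filterlim_real)

lemma m_sq_over_sqrt_choose:
  "(\<lambda>n. (real (m n))\<^sup>2 / sqrt (real ((n - c) choose (r - 1)))) \<longlonglongrightarrow> \<mu> * sqrt (fact (r - 1))"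
proof -
  have "(\<lambda>n. sqrt (inverse (real ((n - c) choose (r - 1)) / real n ^ (r - 1)))) \<longlonglongrightarrow> sqrt (inverse (1 / fact (r - 1)))"
    by (intro tendsto_real_sqrt tendsto_inverse tendsto_choose_over_power) simp
  from tendsto_mult[OF m_asymp this]
  have "(\<lambda>n. (real (m n))\<^sup>2 / sqrt (real n ^ (r - 1)) * sqrt (inverse (real ((n - c) choose (r - 1)) / real n ^ (r - 1))))
      \<longlonglongrightarrow> \<mu> * sqrt (fact (r - 1))" by simp
  moreover have "\<forall>\<^sub>F n in sequentially. (real (m n))\<^sup>2 / sqrt (real n ^ (r - 1)) * sqrt (inverse (real ((n - c) choose (r - 1)) / real n ^ (r - 1)))
      = (real (m n))\<^sup>2 / sqrt (real ((n - c) choose (r - 1)))"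
    using eventually_gt_at_top[of 0]
    by eventually_elim (simp add: real_sqrt_divide real_sqrt_inverse divide_simps)
  ultimately show ?thesis by (rule Lim_transform_eventually)
qed

lemma m_sq_slack_bounded:
  "\<exists>C. \<forall>\<^sub>F n in sequentially. (real (m n))\<^sup>2 * (1 / sqrt (((n - c) choose (r - 1)) + 1)) \<le> C"
proof -
  have "\<forall>\<^sub>F n in sequentially. (real (m n))\<^sup>2 / sqrt (real ((n - c) choose (r - 1))) < \<mu> * sqrt (fact (r - 1)) + 1"
    by (rule order_tendstoD[OF m_sq_over_sqrt_choose]) simp
  moreover have "\<forall>\<^sub>F n in sequentially. 1 \<le> (n - c) choose (r - 1)"
    using choose_at_top[of "r - 1" c] r by (auto simp: filterlim_at_top)
  ultimately have "\<forall>\<^sub>F n in sequentially. (real (m n))\<^sup>2 * (1 / sqrt (((n - c) choose (r - 1)) + 1)) \<le> \<mu> * sqrt (fact (r - 1)) + 1"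
  proof eventually_elim
    case (elim n)
    have "(real (m n))\<^sup>2 * (1 / sqrt (((n - c) choose (r - 1)) + 1)) \<le> (real (m n))\<^sup>2 * (1 / sqrt ((n - c) choose (r - 1)))"
    proof -
      have "1 / sqrt (real x + 1) \<le> 1 / sqrt x" if "1 \<le> x" for x :: nat
        using that by (intro divide_left_mono real_sqrt_le_mono) auto
      from mult_left_mono[OF this[OF elim(2)], of "(real (m n))\<^sup>2"] show ?thesis by (simp add: add.commute)
    qed
    with elim(1) show ?case by simp
  qed
  then show ?thesis by blast
qed

text \<open>At the critical scale j equations balance 2j vertices; with one vertex fewer a factor
  1/m remains. The case j = k + 1 handles a third vertex joining a matching of size k, and j = 2
  handles triples.\<close>

lemma m_slack_tendsto_0:
  assumes "1 \<le> j"
  shows "(\<lambda>n. real (m n) ^ (2 * j - 1) * (1 / sqrt (((n - c) choose (r - 1)) + 1)) ^ j) \<longlonglongrightarrow> 0"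
proof -
  obtain C where C: "\<forall>\<^sub>F n in sequentially. (real (m n))\<^sup>2 * (1 / sqrt (((n - c) choose (r - 1)) + 1)) \<le> C"
    using m_sq_slack_bounded by blast
  have "(\<lambda>n. C ^ j / real (m n)) \<longlonglongrightarrow> 0"
    by (rule tendsto_divide_0[OF tendsto_const]) (use m_real_top filterlim_at_top_imp_at_infinity in blast)
  then show ?thesis
  proof (rule tendsto_0_le[where K = 1])
    have "\<forall>\<^sub>F n in sequentially. 1 \<le> m n" using m_top by (auto simp: filterlim_at_top)
    with C show "\<forall>\<^sub>F n in sequentially. norm (real (m n) ^ (2 * j - 1) * (1 / sqrt (((n - c) choose (r - 1)) + 1)) ^ j)
        \<le> norm (C ^ j / real (m n)) * 1"
    proof eventually_elim
      case (elim n)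
      let ?s = "1 / sqrt (((n - c) choose (r - 1)) + 1)"
      have "x ^ (2 * j - 1) * y ^ j = (x\<^sup>2 * y) ^ j / x" if "0 < x" for x y :: real
        using assms that by (simp add: power_mult_distrib power_diff flip: power_mult)
      from this[of "real (m n)" ?s] have "real (m n) ^ (2 * j - 1) * ?s ^ j = ((real (m n))\<^sup>2 * ?s) ^ j / real (m n)"
        using elim(2) by simp
      also have "\<dots> \<le> C ^ j / real (m n)"
        using elim(1) by (intro divide_right_mono power_mono) auto
      also have "\<dots> \<le> \<bar>C ^ j / real (m n)\<bar>" by (rule abs_ge_self)
      finally show ?case by simp
    qed
  qed
qed

text \<open>The limiting mean: m^2/2 pairs, each coinciding with probability about (pi N)^(-1/2),
  where N is about n^(r - 1)/(r - 1)!.\<close>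

definition rate :: real where
  "rate = \<mu> * sqrt (fact (r - 1) / pi) / 2"

text \<open>Constant shifts \<open>a\<close> and \<open>c\<close> do not affect the limit, so the
  upper and the lower count of matchings lead to the same value.\<close>

lemma pairs_central_tendsto:
  "(\<lambda>n. real ((m n - a) choose 2) * central ((n - c) choose (r - 1))) \<longlonglongrightarrow> rate"
proof -
  have "(\<lambda>n. real ((n - a) choose 2) / real n ^ 2) \<longlonglongrightarrow> 1 / fact 2"
    by (rule tendsto_choose_over_power)
  then have 1: "(\<lambda>n. real ((m n - a) choose 2) / real (m n) ^ 2) \<longlonglongrightarrow> 1 / 2"
    using m_top filterlim_compose[of "\<lambda>n. real ((n - a) choose 2) / real n ^ 2" "nhds (1 / fact 2)" sequentially m sequentially]
    by simp
  have 2: "(\<lambda>n. central ((n - c) choose (r - 1)) * sqrt ((n - c) choose (r - 1))) \<longlonglongrightarrow> 1 / sqrt pi"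
    using filterlim_compose[OF central_asymp choose_at_top[of "r - 1" c]] r by simp
  from tendsto_mult[OF tendsto_mult[OF 1 m_sq_over_sqrt_choose[of c]] 2]
  have "(\<lambda>n. real ((m n - a) choose 2) / real (m n) ^ 2 * ((real (m n))\<^sup>2 / sqrt (real ((n - c) choose (r - 1))))
      * (central ((n - c) choose (r - 1)) * sqrt ((n - c) choose (r - 1)))) \<longlonglongrightarrow> rate"
    by (simp add: rate_def real_sqrt_divide mult.commute)
  moreover have "\<forall>\<^sub>F n in sequentially. 1 \<le> m n" using m_top by (auto simp: filterlim_at_top)
  moreover have "\<forall>\<^sub>F n in sequentially. 1 \<le> (n - c) choose (r - 1)"
    using choose_at_top[of "r - 1" c] r by (auto simp: filterlim_at_top)
  then have "\<forall>\<^sub>F n in sequentially. real ((m n - a) choose 2) / real (m n) ^ 2 * ((real (m n))\<^sup>2 / sqrt (real ((n - c) choose (r - 1))))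
      * (central ((n - c) choose (r - 1)) * sqrt ((n - c) choose (r - 1)))
      = real ((m n - a) choose 2) * central ((n - c) choose (r - 1))"
    using \<open>\<forall>\<^sub>F n in sequentially. 1 \<le> m n\<close>
  proof eventually_elim
    case (elim n)
    have "x / y\<^sup>2 * (y\<^sup>2 / sqrt z) * (d * sqrt z) = x * d" if "1 \<le> y" "1 \<le> z" for x y z d :: real
      using that by simp
    from this[of "real (m n)" "real ((n - c) choose (r - 1))"] show ?case
      using elim of_nat_mono[of 1 _, where 'a = real] by fastforce
  qed
  ultimately show ?thesis by (blast intro: Lim_transform_eventually)
qed

lemma matchings_central_tendsto:
  "(\<lambda>n. real (card (matchings (m n) k)) * central ((n - 2 * k) choose (r - 1)) ^ k) \<longlonglongrightarrow> rate ^ k / fact k"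
proof (rule tendsto_sandwich)
  let ?c = "\<lambda>n. central ((n - 2 * k) choose (r - 1))"
  show "(\<lambda>n. (real ((m n - 2 * k) choose 2) * ?c n) ^ k / fact k) \<longlonglongrightarrow> rate ^ k / fact k"
    by (intro tendsto_divide tendsto_power pairs_central_tendsto tendsto_const) simp
  show "(\<lambda>n. (real ((m n - 0) choose 2) * ?c n) ^ k / fact k) \<longlonglongrightarrow> rate ^ k / fact k"
    by (intro tendsto_divide tendsto_power pairs_central_tendsto tendsto_const) simp
  have ge: "real ((x - 2 * k) choose 2) ^ k \<le> fact k * real (card (matchings x k))"
    and le: "fact k * real (card (matchings x k)) \<le> real (x choose 2) ^ k" for x
    using of_nat_mono[OF card_matchings_ge[of x k], where 'a = real]
      of_nat_mono[OF card_matchings_le[of k x], where 'a = real] by simp_all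
  have nonneg: "0 \<le> ?c n ^ k" for n using central_pos by (simp add: less_imp_le)
  show "\<forall>\<^sub>F n in sequentially. (real ((m n - 2 * k) choose 2) * ?c n) ^ k / fact k
      \<le> real (card (matchings (m n) k)) * ?c n ^ k"
    using mult_right_mono[OF ge nonneg] by (simp add: power_mult_distrib field_simps)
  show "\<forall>\<^sub>F n in sequentially. real (card (matchings (m n) k)) * ?c n ^ k
      \<le> (real ((m n - 0) choose 2) * ?c n) ^ k / fact k"
    using mult_right_mono[OF le nonneg] by (simp add: power_mult_distrib field_simps)
qed

text \<open>From below, every matching loses a relative error \<open>?eps\<close> caused by the
  exposed edges and an additive error \<open>?err\<close> caused by a third vertex. Both vanish
  after summation over all matchings.\<close>

lemma factorial_moment_tendsto:
  "(\<lambda>n. avg (edges r n) (\<lambda>E. real (card (isolated_collisions (m n) E) choose k))) \<longlonglongrightarrow> rate ^ k / fact k"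
proof (rule tendsto_sandwich)
  let ?N = "\<lambda>n. (n - 2 * k) choose (r - 1)"
  let ?c = "\<lambda>n. real (card (matchings (m n) k))"
  let ?eps = "\<lambda>n. k * (real ((n - 1) choose (r - 1)) - ?N n) / (2 * ?N n)"
  let ?s = "\<lambda>n. 1 / sqrt (((n - (2 * k + 1)) choose (r - 1)) + 1)"
  let ?err = "\<lambda>n. k * m n * ?s n ^ (k + 1)"
  have N_pos: "\<forall>\<^sub>F n in sequentially. 1 \<le> ?N n"
    using choose_at_top[of "r - 1" "2 * k"] r by (auto simp: filterlim_at_top)
  show "\<forall>\<^sub>F n in sequentially. avg (edges r n) (\<lambda>E. real (card (isolated_collisions (m n) E) choose k)) \<le> ?c n * central (?N n) ^ k"
    using N_pos
  proof eventually_elim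
    case (elim n)
    show ?case
      unfolding avg_choose_isolated
    proof (rule sum_bounded_above)
      fix Q assume "Q \<in> matchings (m n) k"
      then show "pr (edges r n) (\<lambda>E. Q \<subseteq> isolated_collisions (m n) E) \<le> central (?N n) ^ k"
        using elim r by (intro pr_isolated_le[OF _ m_le]) linarith+
    qed
  qed
  show "\<forall>\<^sub>F n in sequentially. ?c n * central (?N n) ^ k * (1 - ?eps n) - ?c n * ?err n
      \<le> avg (edges r n) (\<lambda>E. real (card (isolated_collisions (m n) E) choose k))"
    using N_pos
  proof eventually_elim
    case (elim n)
    have "central (?N n) ^ k * (1 - ?eps n) - ?err n \<le> pr (edges r n) (\<lambda>E. Q \<subseteq> isolated_collisions (m n) E)"
      if Q: "Q \<in> matchings (m n) k" for Q
    proof -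
      note D = matchingsD[OF Q m_le[of n]]
      have 1: "1 \<le> r" and 2: "?N n = (n - 2 * card Q) choose (r - 1)" and 3: "0 < ?N n"
        using r D(4) elim by (simp, simp, linarith)
      show ?thesis
        using pr_matching_ge[OF D(1-3) 1 2 3] pr_isolated_ge[OF Q m_le 1] unfolding D(4) of_nat_mult of_nat_numeral by linarith
    qed
    then have "?c n * (central (?N n) ^ k * (1 - ?eps n) - ?err n)
        \<le> (\<Sum>Q\<in>matchings (m n) k. pr (edges r n) (\<lambda>E. Q \<subseteq> isolated_collisions (m n) E))"
      by (intro sum_bounded_below) auto
    then show ?case unfolding avg_choose_isolated by (simp add: algebra_simps)
  qed
  show "(\<lambda>n. ?c n * central (?N n) ^ k) \<longlonglongrightarrow> rate ^ k / fact k"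
    by (rule matchings_central_tendsto)
  \<comment> \<open>Both binomial coefficients have leading term n^(r - 1)/(r - 1)!, so non-solo
    edges are a vanishing proportion.\<close>
  have ratio: "(\<lambda>n. (real ((n - 1) choose (r - 1)) - ?N n) / ?N n) \<longlonglongrightarrow> 0"
  proof -
    have "(\<lambda>n. (real ((n - 1) choose (r - 1)) / real n ^ (r - 1)) / (real (?N n) / real n ^ (r - 1)) - 1)
        \<longlonglongrightarrow> (1 / fact (r - 1)) / (1 / fact (r - 1)) - 1"
      by (intro tendsto_diff tendsto_divide tendsto_choose_over_power tendsto_const) simp
    moreover have "\<forall>\<^sub>F n in sequentially. (real ((n - 1) choose (r - 1)) / real n ^ (r - 1)) / (real (?N n) / real n ^ (r - 1)) - 1
        = (real ((n - 1) choose (r - 1)) - ?N n) / ?N n"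
      using N_pos eventually_gt_at_top[of 0]
    proof eventually_elim
      case (elim n)
      have "x / p / (y / p) - 1 = (x - y) / y" if "0 < p" "1 \<le> y" for x y p :: real
        using that by (simp add: field_simps)
      moreover have "0 < real n ^ (r - 1)" "1 \<le> real (?N n)" using elim by (simp, linarith)
      ultimately show ?case by blast
    qed
    ultimately show ?thesis by (simp add: Lim_transform_eventually)
  qed
  have "(\<lambda>n. real k * ((real ((n - 1) choose (r - 1)) - ?N n) / ?N n) / 2) \<longlonglongrightarrow> real k * 0 / 2"
    by (intro tendsto_mult tendsto_divide tendsto_const ratio) simp
  then have eps: "?eps \<longlonglongrightarrow> 0" by (simp add: mult.commute)
  have err: "(\<lambda>n. ?c n * ?err n) \<longlonglongrightarrow> 0"
  proof (rule tendsto_0_le[where K = "real k"])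
    show "(\<lambda>n. real (m n) ^ (2 * (k + 1) - 1) * ?s n ^ (k + 1)) \<longlonglongrightarrow> 0"
      by (rule m_slack_tendsto_0) simp
    \<comment> \<open>The m^(2k) matchings and the additional factor m in \<open>?err\<close> give
      the odd exponent 2k + 1.\<close>
    have "?c n \<le> real (m n) ^ (2 * k)" for n
    proof -
      have "card (matchings (m n) k) \<le> fact k * card (matchings (m n) k)" by (simp add: fact_ge_1)
      also have "\<dots> \<le> (m n choose 2) ^ k" by (rule card_matchings_le)
      also have "\<dots> \<le> ((m n)\<^sup>2) ^ k" using binomial_fact_pow[of "m n" 2] by (intro power_mono) auto
      finally show ?thesis by (simp flip: of_nat_power power_mult)
    qed
    then have "?c n * ?err n \<le> real (m n) ^ (2 * k) * ?err n" for n
      by (intro mult_right_mono) auto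
    then show "\<forall>\<^sub>F n in sequentially. norm (?c n * ?err n) \<le> norm (real (m n) ^ (2 * (k + 1) - 1) * ?s n ^ (k + 1)) * real k"
      by (intro always_eventually allI) (simp add: abs_mult ac_simps)
  qed
  have "(\<lambda>n. ?c n * central (?N n) ^ k * (1 - ?eps n) - ?c n * ?err n) \<longlonglongrightarrow> rate ^ k / fact k * (1 - 0) - 0"
    by (intro tendsto_diff tendsto_mult matchings_central_tendsto eps err tendsto_const)
  then show "(\<lambda>n. ?c n * central (?N n) ^ k * (1 - ?eps n) - ?c n * ?err n) \<longlonglongrightarrow> rate ^ k / fact k" by simp
qed

lemma pr_degrees_inj_tendsto:
  "(\<lambda>n. pr (edges r n) (\<lambda>E. inj_on (deg E) {1..m n})) \<longlonglongrightarrow> exp (- rate)"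
proof -
  let ?iso = "\<lambda>n. pr (edges r n) (\<lambda>E. isolated_collisions (m n) E = {})"
  let ?inj = "\<lambda>n. pr (edges r n) (\<lambda>E. inj_on (deg E) {1..m n})"
  have "?iso \<longlonglongrightarrow> exp (- rate)"
    by (rule poisson_limit[OF factorial_moment_tendsto pr_no_isolated])
  moreover have "(\<lambda>n. ?inj n - ?iso n) \<longlonglongrightarrow> 0"
  proof (rule tendsto_0_le[where K = 1])
    show "(\<lambda>n. real (m n) ^ (2 * 2 - 1) * (1 / sqrt (((n - 3) choose (r - 1)) + 1)) ^ 2) \<longlonglongrightarrow> 0"
      by (rule m_slack_tendsto_0) simp
    show "\<forall>\<^sub>F n in sequentially. norm (?inj n - ?iso n)
        \<le> norm (real (m n) ^ (2 * 2 - 1) * (1 / sqrt (((n - 3) choose (r - 1)) + 1)) ^ 2) * 1"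
    proof (intro always_eventually allI)
      fix n
      show "norm (?inj n - ?iso n)
        \<le> norm (real (m n) ^ (2 * 2 - 1) * (1 / sqrt (((n - 3) choose (r - 1)) + 1)) ^ 2) * 1"
        using pr_triple_le[OF m_le[of n], of r] r by simp
    qed
  qed
  ultimately have "(\<lambda>n. ?iso n + (?inj n - ?iso n)) \<longlonglongrightarrow> exp (- rate) + 0"
    by (rule tendsto_add)
  then show ?thesis by simp
qed

end

section \<open>Weightings with two weights\<close>

text \<open>Choosing weights from {1, 2} amounts to choosing the set \<open>F\<close> of edges of
  weight 2, whose degrees are added to those of \<open>E\<close>.\<close>

lemma induced_colour_two:
  assumes "finite E" "F \<subseteq> E"
  shows "induced_colour E (\<lambda>e. if e \<in> F then 2 else 1) v = deg E v + deg F v"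
proof -
  let ?Ev = "{e\<in>E. v \<in> e}"
  have "induced_colour E (\<lambda>e. if e \<in> F then 2 else 1) v = (\<Sum>e\<in>?Ev. 1 + of_bool (e \<in> F))"
    unfolding induced_colour_def by (intro sum.cong) auto
  also have "\<dots> = card ?Ev + card (?Ev \<inter> F)"
  proof -
    have "finite ?Ev" using assms(1) by simp
    then have "(\<Sum>e\<in>?Ev. of_bool (e \<in> F)) = card (?Ev \<inter> F)"
      by (simp only: of_bool_def sum.If_cases Collect_mem_eq) simp
    then show ?thesis by (simp only: sum.distrib) simp
  qed
  also have "?Ev \<inter> F = {e\<in>F. v \<in> e}" using assms(2) by auto
  finally show ?thesis by (simp add: deg_def)
qed

lemma strongly_weighted_2I:
  assumes "finite E" "F \<subseteq> E" "\<And>e. e \<in> E \<Longrightarrow> e \<subseteq> V" "inj_on (\<lambda>v. deg E v + deg F v) V"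
  shows "strongly_weighted 2 E"
  unfolding strongly_weighted_def
proof (intro exI conjI ballI impI)
  let ?\<omega> = "\<lambda>e. if e \<in> F then 2 else 1 :: nat"
  fix e u v assume e: "e \<in> E" "u \<in> e" "v \<in> e" "u \<noteq> v"
  then have "deg E u + deg F u \<noteq> deg E v + deg F v"
    using assms(3)[OF e(1)] inj_onD[OF assms(4), of u v] by blast
  then show "induced_colour E ?\<omega> u \<noteq> induced_colour E ?\<omega> v"
    by (simp only: induced_colour_two[OF assms(1,2)] not_False_eq_True)
qed auto

section \<open>Separating colours greedily\<close>

lemma deg_Un_disjoint:
  assumes "finite F" "finite H" "F \<inter> H = {}"
  shows "deg (F \<union> H) v = deg F v + deg H v"
proof -
  have "{e\<in>F \<union> H. v \<in> e} = {e\<in>F. v \<in> e} \<union> {e\<in>H. v \<in> e}" by auto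
  then show ?thesis using assms unfolding deg_def by (simp add: card_Un_disjoint disjoint_iff)
qed

lemma deg_eq_0: "(\<And>e. e \<in> H \<Longrightarrow> v \<notin> e) \<Longrightarrow> deg H v = 0"
  unfolding deg_def by (metis (mono_tags, lifting) Collect_empty_eq card.empty)

lemma deg_eq_card: "(\<And>e. e \<in> H \<Longrightarrow> v \<in> e) \<Longrightarrow> deg H v = card H"
  unfolding deg_def by (metis (mono_tags, lifting) Collect_cong Collect_mem_eq)

text \<open>Vertices of \<open>V\<close> are treated one by one. Adding j edges of
  \<open>G x\<close> shifts \<open>x\<close> by j and leaves the rest of \<open>V\<close> and
  \<open>Z\<close> alone, so the \<open>card (G x) + 1\<close> possible colours outnumber those
  already taken. \<open>Z\<close> holds vertices separated earlier and \<open>F\<close> the edges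
  already chosen.\<close>

lemma greedy_recolouring:
  assumes "finite V" "finite Z" "V \<inter> Z = {}" "finite F" "inj_on (\<lambda>v. b v + deg F v) Z"
    and "\<And>x. x \<in> V \<Longrightarrow> finite (G x)"
    and "\<And>x e. x \<in> V \<Longrightarrow> e \<in> G x \<Longrightarrow> e \<inter> V = {x} \<and> e \<inter> Z = {} \<and> e \<notin> F"
    and "\<And>x. x \<in> V \<Longrightarrow> card V + card Z \<le> card (G x)"
  shows "\<exists>H. H \<subseteq> (\<Union>x\<in>V. G x) \<and> inj_on (\<lambda>v. b v + deg (F \<union> H) v) (V \<union> Z)"
  using assms
proof (induction V rule: finite_induct)
  case empty
  then show ?case by (intro exI[of _ "{}"]) simp
next
  case (insert x V)
  have "\<exists>H. H \<subseteq> (\<Union>x\<in>V. G x) \<and> inj_on (\<lambda>v. b v + deg (F \<union> H) v) (V \<union> Z)"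
  proof (rule insert.IH)
    fix y e assume ye: "y \<in> V" "e \<in> G y"
    then have e: "e \<inter> insert x V = {y}" "e \<inter> Z = {}" "e \<notin> F" using insert.prems(6)[of y e] by auto
    then have "e \<inter> V = {y}" using ye(1) by auto
    then show "e \<inter> V = {y} \<and> e \<inter> Z = {} \<and> e \<notin> F" using e by simp
  next
    fix y assume "y \<in> V"
    then show "card V + card Z \<le> card (G y)" using insert.prems(7)[of y] insert.hyps by simp
  qed (use insert.prems in auto)
  then obtain H where H: "H \<subseteq> (\<Union>x\<in>V. G x)" and inj: "inj_on (\<lambda>v. b v + deg (F \<union> H) v) (V \<union> Z)"
    by blast
  let ?c = "\<lambda>v. b v + deg (F \<union> H) v"
  \<comment> \<open>Pigeonhole: some shift avoids all colours in use.\<close>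
  have "\<not> (\<lambda>j. ?c x + j) ` {0..card (G x)} \<subseteq> ?c ` (V \<union> Z)"
  proof
    assume "(\<lambda>j. ?c x + j) ` {0..card (G x)} \<subseteq> ?c ` (V \<union> Z)"
    then have "card ((\<lambda>j. ?c x + j) ` {0..card (G x)}) \<le> card (?c ` (V \<union> Z))"
      using insert by (intro card_mono) auto
    also have "\<dots> \<le> card (V \<union> Z)" using insert by (intro card_image_le) auto
    also have "\<dots> \<le> card V + card Z" by (rule card_Un_le)
    finally show False
      using insert.prems(7)[of x] insert.hyps by (simp add: card_image)
  qed
  then obtain j where "j \<in> {0..card (G x)}" and "?c x + j \<notin> ?c ` (V \<union> Z)"
    unfolding image_subset_iff by blast
  then have j: "j \<le> card (G x)" "?c x + j \<notin> ?c ` (V \<union> Z)" by simp_all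
  obtain J where J: "J \<subseteq> G x" "card J = j" using obtain_subset_with_card_n[OF j(1)] by blast
  have finJ: "finite J" using J(1) insert.prems(5)[of x] finite_subset by auto
  have finH: "finite H" using H insert.hyps(1) insert.prems(5) by (auto intro: finite_subset)
  have Jx: "e \<inter> insert x V = {x}" "e \<inter> Z = {}" "e \<notin> F" if "e \<in> J" for e
    using insert.prems(6)[of x e] that J(1) by auto
  have JH: "e \<notin> H" if "e \<in> J" for e
  proof
    assume "e \<in> H"
    then obtain y where "y \<in> V" "e \<in> G y" using H by auto
    then have "y \<in> e" using insert.prems(6)[of y e] by auto
    then show False using Jx(1)[OF that] \<open>y \<in> V\<close> insert.hyps(2) by auto
  qed
  have deg: "deg (F \<union> (H \<union> J)) v = deg (F \<union> H) v + deg J v" for v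
  proof -
    have "(F \<union> H) \<inter> J = {}" using Jx(3) JH by blast
    then show ?thesis
      using deg_Un_disjoint[of "F \<union> H" J v] finJ finH insert.prems(3) by (simp add: Un_assoc)
  qed
  have "deg J x = j"
  proof (subst deg_eq_card)
    fix e assume "e \<in> J"
    from Jx(1)[OF this] show "x \<in> e" by auto
  qed (rule J(2))
  moreover have "deg J y = 0" if "y \<in> V \<union> Z" for y
  proof (rule deg_eq_0)
    fix e assume "e \<in> J"
    from Jx(1,2)[OF this] show "y \<notin> e" using that insert.hyps(2) by auto
  qed
  moreover have "x \<notin> V \<union> Z" using insert.hyps(2) insert.prems(2) by auto
  ultimately have same: "\<And>y. y \<in> V \<union> Z \<Longrightarrow> b y + deg (F \<union> (H \<union> J)) y = ?c y"
    and new: "b x + deg (F \<union> (H \<union> J)) x = ?c x + j" and "x \<notin> V \<union> Z"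
    unfolding deg by simp_all
  have "(\<lambda>v. b v + deg (F \<union> (H \<union> J)) v) ` (V \<union> Z) = ?c ` (V \<union> Z)"
    using same by (rule image_cong[OF refl])
  moreover have "inj_on (\<lambda>v. b v + deg (F \<union> (H \<union> J)) v) (V \<union> Z)"
    using inj_on_cong[of "V \<union> Z", OF same] inj by simp
  ultimately have "inj_on (\<lambda>v. b v + deg (F \<union> (H \<union> J)) v) (insert x (V \<union> Z))"
    using j(2) Diff_idemp[of "V \<union> Z" "{x}"] \<open>x \<notin> V \<union> Z\<close>
    by (simp only: inj_on_insert new Diff_empty Diff_insert0 simp_thms)
  moreover have "H \<union> J \<subseteq> (\<Union>y\<in>insert x V. G y)" using H J(1) by blast
  ultimately show ?case unfolding Un_insert_left by blast
qed

text \<open>When the trace set is the complement of \<open>W\<close>, solo edges are those whose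
  other vertices all lie in \<open>W\<close>; so the same notion describes the three classes of
  edges used for recolouring.\<close>

lemma solo_Diff_iff:
  assumes "e \<in> edges r n" "W \<subseteq> {1..n}" "x \<in> {1..n} - W"
  shows "e \<in> solo r n ({1..n} - W) x \<longleftrightarrow> x \<in> e \<and> e \<subseteq> insert x W"
  using assms by (auto simp: solo_def edges_def)

text \<open>The edges with one vertex in \<open>K\<close> and the others in \<open>V\<close> spread the colours of \<open>K\<close>
  far apart and above all others; then the edges with one vertex in \<open>V\<close> and the others in \<open>L\<close>
  separate \<open>V\<close>, and those with one vertex in \<open>L\<close> and the others in \<open>K\<close> separate \<open>L\<close> from
  itself and from \<open>V\<close>, which moves the colours of \<open>K\<close> by at most \<open>D\<close>.\<close>

lemma strongly_weighted_2_partition: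
  assumes r: "3 \<le> r" and E: "E \<subseteq> edges r n"
    and part: "V \<union> L \<union> K = {1..n}" "V \<inter> L = {}" "V \<inter> K = {}" "L \<inter> K = {}"
    and V: "\<And>v. v \<in> V \<Longrightarrow> n \<le> card (E \<inter> solo r n ({1..n} - L) v)"
    and L: "\<And>l. l \<in> L \<Longrightarrow> n \<le> card (E \<inter> solo r n ({1..n} - K) l)"
    and K: "\<And>k. k \<in> K \<Longrightarrow> deg E k \<le> t k" "\<And>k. k \<in> K \<Longrightarrow> t k \<le> deg E k + card (E \<inter> solo r n ({1..n} - V) k)"
    and spread: "\<And>k k'. k \<in> K \<Longrightarrow> k' \<in> K \<Longrightarrow> k < k' \<Longrightarrow> t k + D < t k'"
    and D: "\<And>k. k \<in> K \<Longrightarrow> card {e\<in>edges r n. k \<in> e \<and> e \<subseteq> L \<union> K} \<le> D"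
    and low: "\<And>v k. v \<in> V \<union> L \<Longrightarrow> k \<in> K \<Longrightarrow>
      deg E v + card {e\<in>edges r n. v \<in> e \<and> (\<exists>u\<in>(L \<union> K) - {v}. u \<in> e)} < t k"
  shows "strongly_weighted 2 E"
proof -
  have finE: "finite E" using E by (rule finite_subset_edges)
  have fins: "finite V" "finite L" "finite K" using part(1) by (metis finite_Un finite_atLeastAtMost)+
  have sub: "V \<subseteq> {1..n}" "L \<subseteq> {1..n}" "K \<subseteq> {1..n}" using part(1) by auto
  let ?GV = "\<lambda>v. E \<inter> solo r n ({1..n} - L) v"
  let ?GL = "\<lambda>l. E \<inter> solo r n ({1..n} - K) l"
  let ?GK = "\<lambda>k. E \<inter> solo r n ({1..n} - V) k"
  have card_e: "card e = r" if "e \<in> E" for e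
    using that E by (auto simp: edges_def)
  have G: "e \<in> E \<and> x \<in> e \<and> e \<subseteq> insert x W"
    if "W \<subseteq> {1..n}" "x \<in> {1..n}" "x \<notin> W" "e \<in> E \<inter> solo r n ({1..n} - W) x" for W x e
  proof -
    have e: "e \<in> E" "e \<in> edges r n" "e \<in> solo r n ({1..n} - W) x" using that(4) E by auto
    then show ?thesis using solo_Diff_iff[of e r n W x] that(1-3) by simp
  qed
  have GV: "e \<in> E \<and> v \<in> e \<and> e \<subseteq> insert v L" if "v \<in> V" "e \<in> ?GV v" for v e
    using that sub part(2) by (intro G) auto
  have GL: "e \<in> E \<and> l \<in> e \<and> e \<subseteq> insert l K" if "l \<in> L" "e \<in> ?GL l" for l e
    using that sub part(4) by (intro G) auto
  have GK: "e \<in> E \<and> k \<in> e \<and> e \<subseteq> insert k V" if "k \<in> K" "e \<in> ?GK k" for k e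
    using that sub part(3) by (intro G) auto
  \<comment> \<open>This is where r >= 3 enters: two vertices never exhaust an edge.\<close>
  have third: "\<exists>u\<in>e. u \<noteq> x \<and> u \<noteq> y" if "e \<in> E" for e x y
  proof (rule ccontr)
    assume "\<not> ?thesis"
    then have "e \<subseteq> {x, y}" by auto
    then have "card e \<le> card {x, y}" by (intro card_mono) auto
    also have "\<dots> \<le> 2" by (simp add: card_insert_if)
    finally show False using card_e[OF that] r by simp
  qed
  \<comment> \<open>Exactly as many weight-2 edges as lift \<open>k\<close> from its degree to its
    target \<open>t k\<close>.\<close>
  have "\<exists>S. S \<subseteq> ?GK k \<and> card S = t k - deg E k" if "k \<in> K" for k
    using K(2)[OF that] obtain_subset_with_card_n[of "t k - deg E k" "?GK k"] by (metis diff_le_mono diff_add_inverse)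
  then obtain S where S: "\<And>k. k \<in> K \<Longrightarrow> S k \<subseteq> ?GK k" "\<And>k. k \<in> K \<Longrightarrow> card (S k) = t k - deg E k"
    by metis
  define F0 where "F0 = (\<Union>k\<in>K. S k)"
  have F0: "\<exists>k\<in>K. e \<in> ?GK k" if "e \<in> F0" for e using that S(1) by (auto simp: F0_def)
  have F0E: "F0 \<subseteq> E" using F0 by blast
  have deg_F0: "deg F0 k = t k - deg E k" if k: "k \<in> K" for k
  proof -
    have "{e\<in>F0. k \<in> e} = S k"
    proof (intro equalityI subsetI)
      fix e assume e: "e \<in> {e\<in>F0. k \<in> e}"
      then obtain k' where k': "k' \<in> K" "e \<in> S k'" by (auto simp: F0_def)
      then have "e \<subseteq> insert k' V" using GK S(1) by blast
      then have "k' = k" using e k part(3) by blast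
      then show "e \<in> S k" using k' by simp
    next
      fix e assume "e \<in> S k"
      moreover from this have "k \<in> e" using GK[OF k] S(1)[OF k] by blast
      ultimately show "e \<in> {e\<in>F0. k \<in> e}" using k by (auto simp: F0_def)
    qed
    then show ?thesis using S(2)[OF k] by (simp only: deg_def[of F0])
  qed
  \<comment> \<open>Here \<open>V\<close> need only be separated from itself; its shifts may disturb
    \<open>L\<close>, which is treated afterwards.\<close>
  have "\<exists>H. H \<subseteq> (\<Union>v\<in>V. ?GV v) \<and> inj_on (\<lambda>v. deg E v + deg (F0 \<union> H) v) (V \<union> {})"
  proof (rule greedy_recolouring)
    fix v e assume v: "v \<in> V" and e: "e \<in> ?GV v"
    have "e \<inter> V = {v}" using GV[OF v e] part(2) v by blast
    moreover have "e \<notin> F0"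
    proof
      assume "e \<in> F0"
      then obtain k where "k \<in> K" "k \<in> e" using F0 GK by blast
      then show False using GV[OF v e] part v by blast
    qed
    ultimately show "e \<inter> V = {v} \<and> e \<inter> {} = {} \<and> e \<notin> F0" by simp
  next
    fix v assume "v \<in> V"
    moreover have "card V \<le> n" using card_mono[OF _ sub(1)] by simp
    ultimately show "card V + card {} \<le> card (?GV v)" using V[of v] by simp
  qed (use fins finE F0E finite_subset in auto)
  then obtain H1 where H1: "H1 \<subseteq> (\<Union>v\<in>V. ?GV v)" and inj1: "inj_on (\<lambda>v. deg E v + deg (F0 \<union> H1) v) V"
    by auto
  have H1': "\<exists>v\<in>V. e \<in> ?GV v" if "e \<in> H1" for e using that H1 by auto
  have H1E: "H1 \<subseteq> E" using H1 by auto
  \<comment> \<open>Edges with one vertex in \<open>L\<close> and the rest in \<open>K\<close> miss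
    \<open>V\<close>, so \<open>V\<close> can be the set \<open>Z\<close> of finished
    vertices.\<close>
  have "\<exists>H. H \<subseteq> (\<Union>l\<in>L. ?GL l) \<and> inj_on (\<lambda>v. deg E v + deg ((F0 \<union> H1) \<union> H) v) (L \<union> V)"
  proof (rule greedy_recolouring)
    fix l e assume l: "l \<in> L" and e: "e \<in> ?GL l"
    have 1: "e \<inter> L = {l}" "e \<inter> V = {}" using GL[OF l e] part l by blast+
    have "e \<notin> F0"
    proof
      assume "e \<in> F0"
      then obtain k where k: "k \<in> K" "e \<subseteq> insert k V" using F0 GK by blast
      then show False using 1(1) part by blast
    qed
    moreover have "e \<notin> H1"
    proof
      assume "e \<in> H1"
      then obtain v where "v \<in> V" "v \<in> e" using H1' GV by blast
      then show False using 1(2) by blast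
    qed
    ultimately show "e \<inter> L = {l} \<and> e \<inter> V = {} \<and> e \<notin> F0 \<union> H1" using 1 by simp
  next
    fix l assume "l \<in> L"
    moreover have "card (L \<union> V) \<le> n" using card_mono[of "{1..n}" "L \<union> V"] sub by simp
    ultimately show "card L + card V \<le> card (?GL l)"
      using L[of l] fins part(2) by (simp add: card_Un_disjoint Int_commute)
  qed (use fins finE F0E H1E finite_subset inj1 part(2) in auto)
  then obtain H2 where H2: "H2 \<subseteq> (\<Union>l\<in>L. ?GL l)"
    and inj2: "inj_on (\<lambda>v. deg E v + deg (F0 \<union> H1 \<union> H2) v) (L \<union> V)" by auto
  have H2': "\<exists>l\<in>L. e \<in> ?GL l" if "e \<in> H2" for e using that H2 by auto
  define F where "F = F0 \<union> H1 \<union> H2"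
  have FE: "F \<subseteq> E" using F0E H1E H2 by (auto simp: F_def)
  let ?c = "\<lambda>v. deg E v + deg F v"
  \<comment> \<open>After \<open>F0\<close>, only \<open>H2\<close> can touch \<open>K\<close>:
    edges of \<open>H1\<close> avoid \<open>K\<close>, and those of \<open>H2\<close> lie inside
    \<open>L \<union> K\<close>, where \<open>D\<close> bounds their number at
    \<open>k\<close>.\<close>
  have cK: "t k \<le> ?c k \<and> ?c k \<le> t k + D" if k: "k \<in> K" for k
  proof -
    have "{e\<in>F0. k \<in> e} \<subseteq> {e\<in>F. k \<in> e}" by (auto simp: F_def)
    then have ge: "deg F0 k \<le> deg F k"
      unfolding deg_def using finite_subset[OF FE finE] by (intro card_mono) auto
    have "{e\<in>F. k \<in> e} \<subseteq> {e\<in>F0. k \<in> e} \<union> {e\<in>edges r n. k \<in> e \<and> e \<subseteq> L \<union> K}"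
    proof
      fix e assume e: "e \<in> {e\<in>F. k \<in> e}"
      have "e \<notin> H1"
      proof
        assume "e \<in> H1"
        then obtain v where "v \<in> V" "e \<subseteq> insert v L" using H1' GV by blast
        then show False using e k part by blast
      qed
      moreover have "e \<subseteq> L \<union> K" if "e \<in> H2" using H2'[OF that] GL by blast
      ultimately show "e \<in> {e\<in>F0. k \<in> e} \<union> {e\<in>edges r n. k \<in> e \<and> e \<subseteq> L \<union> K}"
        using e E FE by (auto simp: F_def)
    qed
    then have "deg F k \<le> card ({e\<in>F0. k \<in> e} \<union> {e\<in>edges r n. k \<in> e \<and> e \<subseteq> L \<union> K})"
      unfolding deg_def using finite_subset[OF F0E finE] by (intro card_mono) auto
    also have "\<dots> \<le> deg F0 k + card {e\<in>edges r n. k \<in> e \<and> e \<subseteq> L \<union> K}"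
      unfolding deg_def by (rule card_Un_le)
    finally have "deg F k \<le> deg F0 k + D" using D[OF k] by linarith
    with ge show ?thesis using deg_F0[OF k] K(1)[OF k] by linarith
  qed
  \<comment> \<open>By \<open>third\<close>, every weight-2 edge at \<open>v\<close> contains
    another vertex of the small set \<open>L \<union> K\<close>. Such edges are too few to lift
    \<open>v\<close> to the level of \<open>K\<close>.\<close>
  have cVL: "?c v < t k" if v: "v \<in> V \<union> L" and k: "k \<in> K" for v k
  proof -
    have "{e\<in>F. v \<in> e} \<subseteq> {e\<in>edges r n. v \<in> e \<and> (\<exists>u\<in>(L \<union> K) - {v}. u \<in> e)}"
    proof
      fix e assume e: "e \<in> {e\<in>F. v \<in> e}"
      then have eE: "e \<in> E" using FE by auto
      have "\<exists>u\<in>(L \<union> K) - {v}. u \<in> e"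
      proof -
        consider "e \<in> F0" | "e \<in> H1" | "e \<in> H2" using e by (auto simp: F_def)
        then show ?thesis
        proof cases
          case 1
          then obtain k' where "k' \<in> K" "k' \<in> e" using F0 GK by blast
          then show ?thesis using v part by blast
        next
          case 2
          then obtain v' where v': "v' \<in> V" "e \<subseteq> insert v' L" using H1' GV by blast
          then show ?thesis using third[OF eE, of v v'] by blast
        next
          case 3
          then obtain l where l: "l \<in> L" "e \<subseteq> insert l K" using H2' GL by blast
          then show ?thesis using third[OF eE, of v l] by blast
        qed
      qed
      then show "e \<in> {e\<in>edges r n. v \<in> e \<and> (\<exists>u\<in>(L \<union> K) - {v}. u \<in> e)}"
        using e eE E by auto
    qed
    then have "deg F v \<le> card {e\<in>edges r n. v \<in> e \<and> (\<exists>u\<in>(L \<union> K) - {v}. u \<in> e)}"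
      unfolding deg_def by (intro card_mono) auto
    then show ?thesis using low[OF v k] by linarith
  qed
  have less: "?c k < ?c k'" if "k \<in> K" "k' \<in> K" "k < k'" for k k'
    using cK[OF that(1)] cK[OF that(2)] spread[OF that] by linarith
  have "inj_on ?c {1..n}"
  proof (rule inj_onI)
    fix x y assume xy: "x \<in> {1..n}" "y \<in> {1..n}" and eq: "?c x = ?c y"
    consider "x \<in> L \<union> V" "y \<in> L \<union> V" | "x \<in> L \<union> V" "y \<in> K" | "x \<in> K" "y \<in> L \<union> V" | "x \<in> K" "y \<in> K"
      using xy unfolding part(1)[symmetric] by blast
    then show "x = y"
    proof cases
      case 1
      then show ?thesis using inj_onD[OF inj2] eq unfolding F_def by blast
    next
      case 2
      then show ?thesis using cVL[of x y] cK[of y] eq by fastforce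
    next
      case 3
      then show ?thesis using cVL[of y x] cK[of x] eq by fastforce
    next
      case 4
      then show ?thesis using less[of x y] less[of y x] eq by (metis linorder_neqE_nat less_irrefl)
    qed
  qed
  then show ?thesis
    using strongly_weighted_2I[OF finE FE, of "{1..n}"] E by (auto simp: edges_def)
qed

section \<open>The partition conditions hold with high probability\<close>

lemma pr_deviation_le:
  assumes "finite S" "finite I" "\<And>i. i \<in> I \<Longrightarrow> D i \<subseteq> S \<and> card (D i) = c" "0 < c"
  shows "pr S (\<lambda>E. \<exists>i\<in>I. real c / 20 \<le> \<bar>card (E \<inter> D i) - real c / 2\<bar>) \<le> card I * (100 / real c)"
proof (rule pr_bex_le_const[OF assms(2)])
  fix i assume i: "i \<in> I"
  \<comment> \<open>The deviation c/20 makes the Chebyshev bound c/(4 (c/20)^2) = 100/c.\<close>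
  have "pr S (\<lambda>E. real c / 20 \<le> \<bar>card (E \<inter> D i) - real (card (D i)) / 2\<bar>) \<le> card (D i) / (4 * (real c / 20)\<^sup>2)"
    using assms(3)[OF i] assms(4) by (intro chebyshev_card_Int assms(1)) auto
  then show "pr S (\<lambda>E. real c / 20 \<le> \<bar>card (E \<inter> D i) - real c / 2\<bar>) \<le> 100 / real c"
    using assms(3)[OF i] assms(4) by (simp add: power2_eq_square)
qed

lemma card_solo_Diff:
  assumes "W \<subseteq> {1..n}" "x \<in> {1..n} - W" "1 \<le> r"
  shows "card (solo r n ({1..n} - W) x) = card W choose (r - 1)"
proof -
  have "card W \<le> n" using card_mono[OF _ assms(1)] by simp
  then have "n - card ({1..n} - W) = card W"
    using assms(1) finite_subset[OF assms(1)] by (simp add: card_Diff_subset)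
  then show ?thesis using card_solo[of x "{1..n} - W" n r] assms by simp
qed

lemma choose_le_power: "(n choose k) \<le> n ^ k"
proof -
  have "(n choose k) * 1 \<le> (n choose k) * fact k" by (intro mult_left_mono) (auto simp: fact_ge_1)
  also have "\<dots> \<le> n ^ k" by (rule binomial_fact_pow)
  finally show ?thesis by simp
qed

lemma card_edges_meeting_le:
  assumes "v \<in> {1..n}" "W \<subseteq> {1..n}" "2 \<le> r"
  shows "card {e\<in>edges r n. v \<in> e \<and> (\<exists>u\<in>W - {v}. u \<in> e)} \<le> card W * n ^ (r - 2)"
proof -
  have fin: "finite W" using assms(2) by (rule finite_subset) simp
  have "{e\<in>edges r n. v \<in> e \<and> (\<exists>u\<in>W - {v}. u \<in> e)} = (\<Union>u\<in>W - {v}. {e\<in>edges r n. {v, u} \<subseteq> e})" by auto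
  then have "card {e\<in>edges r n. v \<in> e \<and> (\<exists>u\<in>W - {v}. u \<in> e)} \<le> (\<Sum>u\<in>W - {v}. card {e\<in>edges r n. {v, u} \<subseteq> e})"
    using card_UN_le[of "W - {v}" "\<lambda>u. {e\<in>edges r n. {v, u} \<subseteq> e}"] fin by simp
  also have "\<dots> \<le> (\<Sum>u\<in>W - {v}. n ^ (r - 2))"
  proof (rule sum_mono)
    fix u assume "u \<in> W - {v}"
    then have "card {v, u} = 2" "{v, u} \<subseteq> {1..n}" using assms(1,2) by auto
    then have "card {e\<in>edges r n. {v, u} \<subseteq> e} = (n - 2) choose (r - 2)"
      using card_edges_superset[of "{v, u}" n r] assms(3) by simp
    also have "\<dots> \<le> (n - 2) ^ (r - 2)" by (rule choose_le_power)
    also have "\<dots> \<le> n ^ (r - 2)" by (intro power_mono) auto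
    finally show "card {e\<in>edges r n. {v, u} \<subseteq> e} \<le> n ^ (r - 2)" .
  qed
  also have "\<dots> \<le> card W * n ^ (r - 2)"
    using card_mono[OF fin, of "W - {v}"] by (simp add: Diff_subset)
  finally show ?thesis .
qed

text \<open>Outside a rare event all counts lie between 9/20 and 11/20 of their size.
  \<open>C\<^sub>0\<close> is the number of potential edges at a vertex, \<open>C\<^sub>1\<close>
  the supply for each greedy step and \<open>C\<^sub>2\<close> the supply for lifting
  \<open>K\<close>. Targets near 3/5 of \<open>C\<^sub>0\<close> are above all degrees, and
  \<open>h2\<close> keeps them reachable: 3/20 = 3/5 - 9/20 is the part of the lift not present in
  the degree.\<close>

lemma pr_not_strongly_weighted_2_le:
  assumes r: "3 \<le> r" and m: "2 * m \<le> n"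
    and C: "C\<^sub>0 = (n - 1) choose (r - 1)" "C\<^sub>1 = m choose (r - 1)" "C\<^sub>2 = (n - 2 * m) choose (r - 1)"
      "0 < C\<^sub>0" "0 < C\<^sub>1" "0 < C\<^sub>2"
    and h1: "real n \<le> 9 / 20 * C\<^sub>1"
    and h2: "3 / 20 * real C\<^sub>0 + 1 + m * ((2 * m) ^ (r - 1) + 1) \<le> 9 / 20 * real C\<^sub>2"
    and h3: "2 * m * n ^ (r - 2) < real C\<^sub>0 / 20"
  shows "pr (edges r n) (\<lambda>E. \<not> strongly_weighted 2 E)
    \<le> 100 * (real n / C\<^sub>0) + 200 * (real n / C\<^sub>1) + 100 * (real n / C\<^sub>2)"
proof -
  define V L K where "V = {1..n - 2 * m}" and "L = {n - 2 * m + 1..n - m}" and "K = {n - m + 1..n}"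
  have part: "V \<union> L \<union> K = {1..n}" "V \<inter> L = {}" "V \<inter> K = {}" "L \<inter> K = {}"
    using m by (auto simp: V_def L_def K_def)
  have sub: "V \<subseteq> {1..n}" "L \<subseteq> {1..n}" "K \<subseteq> {1..n}" using part(1) by auto
  have fins: "finite V" "finite L" "finite K" by (simp_all add: V_def L_def K_def)
  have cards: "card V = n - 2 * m" "card L = m" "card K = m" using m by (auto simp: V_def L_def K_def)
  let ?star = "\<lambda>v. {e\<in>edges r n. v \<in> e}"
  let ?SV = "\<lambda>v. solo r n ({1..n} - L) v" and ?SL = "\<lambda>l. solo r n ({1..n} - K) l" and ?SK = "\<lambda>k. solo r n ({1..n} - V) k"
  let ?dev = "\<lambda>c X E. real c / 20 \<le> \<bar>card (E \<inter> X) - real c / 2\<bar>"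
  \<comment> \<open>At most this many edges through a vertex of \<open>K\<close> stay inside
    \<open>L \<union> K\<close>, a set of 2m vertices.\<close>
  define D where "D = (2 * m) ^ (r - 1)"
  \<comment> \<open>3/5 = 11/20 + 1/20: the largest degree plus the bound \<open>h3\<close> on the
    shifts of \<open>V\<close> and \<open>L\<close>.\<close>
  define B where "B = nat \<lceil>3 / 5 * real C\<^sub>0\<rceil>"
  \<comment> \<open>Targets are D + 1 apart, one more than the later disturbance. As k - (n - m)
    runs through 1..m, their total span is at most m (D + 1), the term appearing in
    \<open>h2\<close>.\<close>
  define t where "t = (\<lambda>k. B + (k - (n - m)) * (D + 1))"
  have B: "3 / 5 * real C\<^sub>0 \<le> B" "B \<le> 3 / 5 * real C\<^sub>0 + 1"
    unfolding B_def by linarith+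
  have good: "strongly_weighted 2 E"
    if E: "E \<subseteq> edges r n" and dev: "\<not> (\<exists>v\<in>{1..n}. ?dev C\<^sub>0 (?star v) E)" "\<not> (\<exists>v\<in>V. ?dev C\<^sub>1 (?SV v) E)"
      "\<not> (\<exists>l\<in>L. ?dev C\<^sub>1 (?SL l) E)" "\<not> (\<exists>k\<in>K. ?dev C\<^sub>2 (?SK k) E)" for E
  proof (rule strongly_weighted_2_partition[OF r E part, of t D])
    have close: "9 / 20 * real c < card (E \<inter> X)" "card (E \<inter> X) < 11 / 20 * real c" if "\<not> ?dev c X E" for c X
      using that by linarith+
    have deg: "9 / 20 * real C\<^sub>0 < deg E v" "deg E v < 11 / 20 * real C\<^sub>0" if "v \<in> {1..n}" for v
    proof -
      have "E \<inter> ?star v = {e\<in>E. v \<in> e}" using E by auto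
      moreover have "\<not> ?dev C\<^sub>0 (?star v) E" using dev(1) that by blast
      ultimately show "9 / 20 * real C\<^sub>0 < deg E v" "deg E v < 11 / 20 * real C\<^sub>0"
        using close[of C\<^sub>0 "?star v"] by (simp_all add: deg_def)
    qed
    show "n \<le> card (E \<inter> ?SV v)" if "v \<in> V" for v
      proof -
      have "\<not> ?dev C\<^sub>1 (?SV v) E" using dev(2) that by blast
      from close(1)[OF this] h1 show ?thesis by linarith
    qed
    show "n \<le> card (E \<inter> ?SL l)" if "l \<in> L" for l
      proof -
      have "\<not> ?dev C\<^sub>1 (?SL l) E" using dev(3) that by blast
      from close(1)[OF this] h1 show ?thesis by linarith
    qed
    have t_ge: "B \<le> t k" for k by (simp add: t_def)
    show "deg E k \<le> t k" if "k \<in> K" for k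
    proof -
      have "real (deg E k) < B" using deg(2)[of k] sub(3) that B(1) by fastforce
      then show ?thesis using t_ge[of k] by linarith
    qed
    show "t k \<le> deg E k + card (E \<inter> ?SK k)" if k: "k \<in> K" for k
    proof -
      have "k - (n - m) \<le> m" using k by (auto simp: K_def)
      then have "t k \<le> B + m * (D + 1)"
        unfolding t_def by (intro add_mono mult_right_mono) auto
      then have "real (t k) \<le> B + real (m * (D + 1))" by (metis of_nat_add of_nat_le_iff)
      also have "\<dots> \<le> 9 / 20 * C\<^sub>0 + 9 / 20 * C\<^sub>2"
        using B(2) h2
        unfolding D_def of_nat_mult of_nat_add of_nat_power of_nat_numeral of_nat_1 by linarith
      also have "\<dots> \<le> real (deg E k + card (E \<inter> ?SK k))"
      proof -
        have "\<not> ?dev C\<^sub>2 (?SK k) E" "k \<in> {1..n}" using dev(4) k sub(3) by blast+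
        from close(1)[OF this(1)] deg(1)[OF this(2)] show ?thesis by simp
      qed
      finally show ?thesis by (simp only: of_nat_le_iff)
    qed
    show "t k + D < t k'" if "k \<in> K" "k' \<in> K" "k < k'" for k k'
    proof -
      have "k - (n - m) + 1 \<le> k' - (n - m)" using that by (auto simp: K_def)
      moreover have "a * (D + 1) + D < b * (D + 1)" if "a + 1 \<le> b" for a b
        using mult_right_mono[OF that, of "D + 1"] by simp
      ultimately show ?thesis unfolding t_def add.assoc by (intro add_strict_left_mono)
    qed
    show "card {e\<in>edges r n. k \<in> e \<and> e \<subseteq> L \<union> K} \<le> D" if k: "k \<in> K" for k
    proof -
      \<comment> \<open>The vertex \<open>k\<close> is removed because the other vertices of a solo
        edge range over a set not containing \<open>k\<close>.\<close>
      let ?W = "(L \<union> K) - {k}"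
      have W: "?W \<subseteq> {1..n}" "k \<in> {1..n} - ?W" using sub k by auto
      have "{e\<in>edges r n. k \<in> e \<and> e \<subseteq> L \<union> K} \<subseteq> solo r n ({1..n} - ?W) k"
      proof
        fix e assume "e \<in> {e\<in>edges r n. k \<in> e \<and> e \<subseteq> L \<union> K}"
        then have e: "e \<in> edges r n" "k \<in> e" "e \<subseteq> insert k ?W" by auto
        show "e \<in> solo r n ({1..n} - ?W) k"
          using e(2,3) by (intro solo_Diff_iff[OF e(1) W, THEN iffD2] conjI)
      qed
      then have "card {e\<in>edges r n. k \<in> e \<and> e \<subseteq> L \<union> K} \<le> card ?W choose (r - 1)"
        using card_mono[OF finite_solo] card_solo_Diff[OF W, of r] r by (metis (no_types, lifting) le_trans one_le_numeral)
      also have "\<dots> \<le> card ?W ^ (r - 1)" by (rule choose_le_power)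
      also have "card ?W \<le> card (L \<union> K)" using fins by (intro card_mono) auto
      also have "card (L \<union> K) \<le> 2 * m" using card_Un_le[of L K] cards by simp
      finally show ?thesis by (simp add: D_def power_mono)
    qed
    show "deg E v + card {e\<in>edges r n. v \<in> e \<and> (\<exists>u\<in>(L \<union> K) - {v}. u \<in> e)} < t k"
      if v: "v \<in> V \<union> L" and k: "k \<in> K" for v k
    proof -
      have vn: "v \<in> {1..n}" using v sub by auto
      have "card {e\<in>edges r n. v \<in> e \<and> (\<exists>u\<in>(L \<union> K) - {v}. u \<in> e)} \<le> card (L \<union> K) * n ^ (r - 2)"
        using sub r by (intro card_edges_meeting_le vn) auto
      also have "\<dots> \<le> 2 * m * n ^ (r - 2)"
        using card_Un_le[of L K] cards by (intro mult_right_mono) auto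
      finally have "card {e\<in>edges r n. v \<in> e \<and> (\<exists>u\<in>(L \<union> K) - {v}. u \<in> e)} \<le> 2 * m * n ^ (r - 2)" .
      from of_nat_mono[OF this, where 'a = real]
      have "real (card {e\<in>edges r n. v \<in> e \<and> (\<exists>u\<in>(L \<union> K) - {v}. u \<in> e)}) < real C\<^sub>0 / 20"
        using h3 unfolding of_nat_mult of_nat_power of_nat_numeral by linarith
      then have "real (deg E v + card {e\<in>edges r n. v \<in> e \<and> (\<exists>u\<in>(L \<union> K) - {v}. u \<in> e)}) < t k"
        using deg(2)[OF vn] B(1) t_ge[of k] by (simp only: of_nat_add flip: of_nat_le_iff[where 'a = real])
      then show ?thesis by (simp only: of_nat_less_iff)
    qed
  qed
  have "pr (edges r n) (\<lambda>E. \<not> strongly_weighted 2 E)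
      \<le> pr (edges r n) (\<lambda>E. ((\<exists>v\<in>{1..n}. ?dev C\<^sub>0 (?star v) E) \<or> (\<exists>v\<in>V. ?dev C\<^sub>1 (?SV v) E))
        \<or> ((\<exists>l\<in>L. ?dev C\<^sub>1 (?SL l) E) \<or> (\<exists>k\<in>K. ?dev C\<^sub>2 (?SK k) E)))"
    using good by (intro pr_mono) blast
  also have "\<dots> \<le> (pr (edges r n) (\<lambda>E. \<exists>v\<in>{1..n}. ?dev C\<^sub>0 (?star v) E) + pr (edges r n) (\<lambda>E. \<exists>v\<in>V. ?dev C\<^sub>1 (?SV v) E))
      + (pr (edges r n) (\<lambda>E. \<exists>l\<in>L. ?dev C\<^sub>1 (?SL l) E) + pr (edges r n) (\<lambda>E. \<exists>k\<in>K. ?dev C\<^sub>2 (?SK k) E))"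
    by (rule order_trans[OF pr_or_le add_mono[OF pr_or_le pr_or_le]])
  also have "\<dots> \<le> (real n * (100 / C\<^sub>0) + real n * (100 / C\<^sub>1)) + (real n * (100 / C\<^sub>1) + real n * (100 / C\<^sub>2))"
  proof (intro add_mono)
    have le: "card A \<le> n" if "A \<subseteq> {1..n}" for A :: "nat set" using card_mono[OF _ that] by simp
    have weaken: "p \<le> real n * (100 / c)" if "p \<le> card A * (100 / c)" "A \<subseteq> {1..n}" "0 < c" for p c :: real and A :: "nat set"
      using that(1) mult_right_mono[OF of_nat_mono[OF le[OF that(2)], where 'a = real], of "100 / c"] that(3) by simp
    show "pr (edges r n) (\<lambda>E. \<exists>v\<in>{1..n}. ?dev C\<^sub>0 (?star v) E) \<le> real n * (100 / C\<^sub>0)"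
    proof (rule weaken[OF pr_deviation_le])
      fix v assume "v \<in> {1..n}"
      then show "?star v \<subseteq> edges r n \<and> card (?star v) = C\<^sub>0"
        using deg_edges[of v n r] r C(1) by (auto simp: deg_def)
    qed (use C in auto)
    show "pr (edges r n) (\<lambda>E. \<exists>v\<in>V. ?dev C\<^sub>1 (?SV v) E) \<le> real n * (100 / C\<^sub>1)"
    proof (rule weaken[OF pr_deviation_le])
      fix v assume "v \<in> V"
      then have "v \<in> {1..n} - L" using part(2-4) sub by blast
      then show "?SV v \<subseteq> edges r n \<and> card (?SV v) = C\<^sub>1"
        using card_solo_Diff[OF sub(2), of v r] r C(2) cards by (simp add: solo_subset)
    qed (use C sub fins in auto)
    show "pr (edges r n) (\<lambda>E. \<exists>l\<in>L. ?dev C\<^sub>1 (?SL l) E) \<le> real n * (100 / C\<^sub>1)"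
    proof (rule weaken[OF pr_deviation_le])
      fix l assume "l \<in> L"
      then have "l \<in> {1..n} - K" using part(2-4) sub by blast
      then show "?SL l \<subseteq> edges r n \<and> card (?SL l) = C\<^sub>1"
        using card_solo_Diff[OF sub(3), of l r] r C(2) cards by (simp add: solo_subset)
    qed (use C sub fins in auto)
    show "pr (edges r n) (\<lambda>E. \<exists>k\<in>K. ?dev C\<^sub>2 (?SK k) E) \<le> real n * (100 / C\<^sub>2)"
    proof (rule weaken[OF pr_deviation_le])
      fix k assume "k \<in> K"
      then have "k \<in> {1..n} - V" using part(2-4) sub by blast
      then show "?SK k \<subseteq> edges r n \<and> card (?SK k) = C\<^sub>2"
        using card_solo_Diff[OF sub(1), of k r] r C(3) cards by (simp add: solo_subset)
    qed (use C sub fins in auto)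
  qed
  finally show ?thesis by (simp add: algebra_simps)
qed

text \<open>A larger uniformity only helps: with s = r - 1, the ratios need to be checked for the
  exponent 2 alone, the case r = 3.\<close>

lemma tendsto_0_power_ratio:
  fixes f g :: "nat \<Rightarrow> real"
  assumes "(\<lambda>n. f n / g n ^ 2) \<longlonglongrightarrow> 0" "\<forall>\<^sub>F n in sequentially. 1 \<le> g n" "2 \<le> s"
  shows "(\<lambda>n. f n / g n ^ s) \<longlonglongrightarrow> 0"
proof (rule tendsto_0_le[where K = 1, OF assms(1)])
  show "\<forall>\<^sub>F n in sequentially. norm (f n / g n ^ s) \<le> norm (f n / g n ^ 2) * 1"
    using assms(2)
  proof eventually_elim
    case (elim n)
    then have "g n ^ 2 \<le> g n ^ s" using assms(3) by (intro power_increasing) auto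
    moreover have "0 < g n ^ 2" using elim by simp
    ultimately have "\<bar>f n\<bar> / g n ^ s \<le> \<bar>f n\<bar> / g n ^ 2" by (intro frac_le) auto
    then show ?case using elim by simp
  qed
qed

text \<open>The size \<open>m = n\<^sup>3\<^sup>/\<^sup>5\<close> of \<open>L\<close> and \<open>K\<close> satisfies \<open>n = o(m\<^sup>2)\<close>, so that there are enough edges
  for the greedy steps, and \<open>m\<^sup>3 = o(n\<^sup>2)\<close>, so that the colours of \<open>K\<close> can be spread out.\<close>

lemma pr_not_strongly_weighted_2_tendsto_0:
  assumes r: "3 \<le> r"
  shows "(\<lambda>n. pr (edges r n) (\<lambda>E. \<not> strongly_weighted 2 E)) \<longlonglongrightarrow> 0"
proof -
  define m where "m = (\<lambda>n::nat. nat \<lfloor>real n powr (3 / 5)\<rfloor>)"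
  define s where "s = r - 1"
  have s: "2 \<le> s" "r - 2 = s - 1" "r - 1 = s" using r by (auto simp: s_def)
  let ?C0 = "\<lambda>n. (n - 1) choose (r - 1)" and ?C1 = "\<lambda>n. m n choose (r - 1)" and ?C2 = "\<lambda>n. (n - 2 * m n) choose (r - 1)"
  have m_eq: "real (m n) = of_int \<lfloor>real n powr (3 / 5)\<rfloor>" for n
    by (simp add: m_def)
  have a1: "(\<lambda>n. real n / real (m n) ^ 2) \<longlonglongrightarrow> 0" unfolding m_eq by real_asymp
  have a2: "(\<lambda>n. real (m n) ^ 3 / real n ^ 2) \<longlonglongrightarrow> 0" unfolding m_eq by real_asymp
  have a3: "(\<lambda>n. real (m n) / real n) \<longlonglongrightarrow> 0" unfolding m_eq by real_asymp
  have a4: "filterlim (\<lambda>n. real (m n)) at_top sequentially" unfolding m_eq by real_asymp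
  have a5: "(\<lambda>n. real n / real n ^ 2) \<longlonglongrightarrow> 0" by real_asymp
  have a6: "\<forall>\<^sub>F n in sequentially. 2 * real (m n) + 1 \<le> real n" unfolding m_eq by real_asymp
  have a7: "(\<lambda>n. 1 / real n ^ 2) \<longlonglongrightarrow> 0" by real_asymp
  have m_top: "filterlim m at_top sequentially"
    using a4 by (simp add: filterlim_sequentially_iff_filterlim_real)
  have n1: "\<forall>\<^sub>F n in sequentially. 1 \<le> real n" by real_asymp
  have m1: "\<forall>\<^sub>F n in sequentially. 1 \<le> real (m n)" using a4 unfolding filterlim_at_top by blast
  have C0: "(\<lambda>n. real (?C0 n) / real n ^ s) \<longlonglongrightarrow> 1 / fact s"
    unfolding s(3) by (rule tendsto_choose_over_power)
  have C1: "(\<lambda>n. real (?C1 n) / real (m n) ^ s) \<longlonglongrightarrow> 1 / fact s"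
    unfolding s(3) using filterlim_compose[OF tendsto_choose_over_power[of 0 s] m_top] by simp
  have C2: "(\<lambda>n. real (?C2 n) / real n ^ s) \<longlonglongrightarrow> 1 / fact s"
  proof -
    have sub: "\<forall>\<^sub>F n in sequentially. real (n - 2 * m n) = real n - 2 * real (m n) \<and> 1 \<le> real (n - 2 * m n)"
      using a6 by eventually_elim linarith
    \<comment> \<open>Since m = o(n), removing 2m vertices does not change the leading term.\<close>
    have "(\<lambda>n. (1 - 2 * (real (m n) / real n)) ^ s) \<longlonglongrightarrow> (1 - 2 * 0) ^ s"
      by (intro tendsto_power tendsto_diff tendsto_mult tendsto_const a3)
    moreover have "filterlim (\<lambda>n. n - 2 * m n) at_top sequentially"
    proof -
      have "filterlim (\<lambda>n. real n - 2 * real (m n)) at_top sequentially" unfolding m_eq by real_asymp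
      then have "filterlim (\<lambda>n. real (n - 2 * m n)) at_top sequentially"
        by (rule filterlim_cong[OF refl refl, THEN iffD1, rotated]) (use sub in \<open>eventually_elim; simp\<close>)
      then show ?thesis by (simp only: filterlim_sequentially_iff_filterlim_real)
    qed
    then have "(\<lambda>n. real (?C2 n) / real (n - 2 * m n) ^ s) \<longlonglongrightarrow> 1 / fact s"
      unfolding s(3) using filterlim_compose[OF tendsto_choose_over_power[of 0 s]] by simp
    ultimately have "(\<lambda>n. (1 - 2 * (real (m n) / real n)) ^ s * (real (?C2 n) / real (n - 2 * m n) ^ s)) \<longlonglongrightarrow> (1 - 2 * 0) ^ s * (1 / fact s)"
      by (rule tendsto_mult)
    moreover have "\<forall>\<^sub>F n in sequentially. (1 - 2 * (real (m n) / real n)) ^ s * (real (?C2 n) / real (n - 2 * m n) ^ s) = real (?C2 n) / real n ^ s"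
      using sub n1
    proof eventually_elim
      case (elim n)
      then have "1 - 2 * (real (m n) / real n) = real (n - 2 * m n) / real n" by (simp add: field_simps)
      moreover have "real (n - 2 * m n) ^ s \<noteq> 0" using elim by simp
      ultimately show ?case by (simp add: power_divide)
    qed
    ultimately show ?thesis by (simp add: Lim_transform_eventually)
  qed
  have ratio: "(\<lambda>n. real n / real (c n)) \<longlonglongrightarrow> 0"
    if c: "(\<lambda>n. real (c n) / g n ^ s) \<longlonglongrightarrow> 1 / fact s" and g: "(\<lambda>n. real n / g n ^ 2) \<longlonglongrightarrow> 0" "\<forall>\<^sub>F n in sequentially. 1 \<le> g n"
    for c g
  proof -
    have "(\<lambda>n. (real n / g n ^ s) / (real (c n) / g n ^ s)) \<longlonglongrightarrow> 0 / (1 / fact s)"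
      by (intro tendsto_divide c tendsto_0_power_ratio[OF g s(1)]) simp
    moreover have "\<forall>\<^sub>F n in sequentially. (real n / g n ^ s) / (real (c n) / g n ^ s) = real n / real (c n)"
      using g(2) by eventually_elim simp
    ultimately show ?thesis by (simp add: Lim_transform_eventually)
  qed
  have l0: "(\<lambda>n. real n / ?C0 n) \<longlonglongrightarrow> 0" by (rule ratio[OF C0 a5 n1])
  have l1: "(\<lambda>n. real n / ?C1 n) \<longlonglongrightarrow> 0" by (rule ratio[OF C1 a1 m1])
  have l2: "(\<lambda>n. real n / ?C2 n) \<longlonglongrightarrow> 0" by (rule ratio[OF C2 a5 n1])
  have pos: "\<forall>\<^sub>F n in sequentially. 0 < c n"
    if "(\<lambda>n. real (c n) / g n ^ s) \<longlonglongrightarrow> 1 / fact s" for c :: "nat \<Rightarrow> nat" and g :: "nat \<Rightarrow> real"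
    using order_tendstoD(1)[OF that, of 0] by (auto elim!: eventually_mono intro: Nat.gr0I)
  have h1: "\<forall>\<^sub>F n in sequentially. real n \<le> 9 / 20 * ?C1 n"
  proof -
    have "\<forall>\<^sub>F n in sequentially. real n / ?C1 n < 9 / 20"
      by (rule order_tendstoD[OF l1]) simp
    with pos[OF C1] show ?thesis
    proof eventually_elim
      case (elim n)
      have "x \<le> 9 / 20 * y" if "0 < y" "x / y < 9 / 20" for x y :: real
        using that by (simp add: divide_less_eq)
      moreover have "0 < real (?C1 n)" using elim(1) by linarith
      ultimately show ?case using elim(2) by blast
    qed
  qed
  have h3: "\<forall>\<^sub>F n in sequentially. 2 * m n * n ^ (r - 2) < real (?C0 n) / 20"
  proof -
    have "(\<lambda>n. real (?C0 n) / real n ^ s / 20 - 2 * (real (m n) / real n)) \<longlonglongrightarrow> 1 / fact s / 20 - 2 * 0"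
      by (intro tendsto_diff tendsto_divide C0 tendsto_mult a3 tendsto_const) simp
    then have "\<forall>\<^sub>F n in sequentially. 0 < real (?C0 n) / real n ^ s / 20 - 2 * (real (m n) / real n)"
      by (rule order_tendstoD) simp
    then show ?thesis
      using n1
    proof eventually_elim
      case (elim n)
      have p: "real n ^ s = real n * real n ^ (r - 2)" using s by (metis Suc_diff_1 less_le_trans pos2 power_Suc)
      have "0 < (real (?C0 n) / real n ^ s / 20 - 2 * (real (m n) / real n)) * real n ^ s"
        using elim by (intro mult_pos_pos) auto
      also have "\<dots> = real (?C0 n) / 20 - 2 * real (m n) * real n ^ (r - 2)"
        using elim(2) unfolding p by (simp add: field_simps)
      finally show ?case by simp
    qed
  qed
  have h2: "\<forall>\<^sub>F n in sequentially. 3 / 20 * real (?C0 n) + 1 + m n * ((2 * m n) ^ (r - 1) + 1) \<le> 9 / 20 * real (?C2 n)"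
  proof -
    have b1: "(\<lambda>n. 1 / real n ^ s) \<longlonglongrightarrow> 0" by (rule tendsto_0_power_ratio[OF a7 n1 s(1)])
    have b2: "(\<lambda>n. real (m n) / real n ^ s) \<longlonglongrightarrow> 0"
    proof (rule tendsto_0_power_ratio[OF _ n1 s(1)])
      show "(\<lambda>n. real (m n) / real n ^ 2) \<longlonglongrightarrow> 0" unfolding m_eq by real_asymp
    qed
    have b3: "(\<lambda>n. real (m n) ^ Suc s / real n ^ s) \<longlonglongrightarrow> 0"
    proof (rule tendsto_0_le[where K = 1, OF a2])
      show "\<forall>\<^sub>F n in sequentially. norm (real (m n) ^ Suc s / real n ^ s) \<le> norm (real (m n) ^ 3 / real n ^ 2) * 1"
        using n1 a6
      proof eventually_elim
        case (elim n)
        obtain d where d: "s = 2 + d" using s(1) le_Suc_ex by blast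
        \<comment> \<open>The surplus exponents are collected in a power of m/n, which is at most
          1.\<close>
        have "real (m n) ^ Suc s / real n ^ s = real (m n) ^ 3 / real n ^ 2 * (real (m n) / real n) ^ d"
          by (simp add: d power_add power_divide power2_eq_square power3_eq_cube)
        also have "\<dots> \<le> real (m n) ^ 3 / real n ^ 2 * 1"
          using elim by (intro mult_left_mono power_le_one) (auto simp: divide_le_eq_1)
        finally show ?case by simp
      qed
    qed
    \<comment> \<open>After division by n^s the limit is (9/20 - 3/20)/s!, which is positive, so the
      inequality holds eventually.\<close>
    have "(\<lambda>n. 9 / 20 * (real (?C2 n) / real n ^ s) - (3 / 20 * (real (?C0 n) / real n ^ s) + 1 / real n ^ s
        + (2 ^ s * (real (m n) ^ Suc s / real n ^ s) + real (m n) / real n ^ s)))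
      \<longlonglongrightarrow> 9 / 20 * (1 / fact s) - (3 / 20 * (1 / fact s) + 0 + (2 ^ s * 0 + 0))"
      by (intro tendsto_diff tendsto_add tendsto_mult tendsto_const C0 C2 b1 b2 b3)
    then have "\<forall>\<^sub>F n in sequentially. 0 < 9 / 20 * (real (?C2 n) / real n ^ s) - (3 / 20 * (real (?C0 n) / real n ^ s) + 1 / real n ^ s
        + (2 ^ s * (real (m n) ^ Suc s / real n ^ s) + real (m n) / real n ^ s))"
      by (rule order_tendstoD) simp
    then show ?thesis
      using n1
    proof eventually_elim
      case (elim n)
      have "0 < (9 / 20 * (real (?C2 n) / real n ^ s) - (3 / 20 * (real (?C0 n) / real n ^ s) + 1 / real n ^ s
        + (2 ^ s * (real (m n) ^ Suc s / real n ^ s) + real (m n) / real n ^ s))) * real n ^ s"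
        using elim by (intro mult_pos_pos) auto
      also have "\<dots> = 9 / 20 * real (?C2 n) - (3 / 20 * real (?C0 n) + 1 + real (m n) * ((2 * real (m n)) ^ s + 1))"
        using elim(2) by (simp add: left_diff_distrib distrib_right power_mult_distrib) (simp add: algebra_simps)
      finally show ?case
        unfolding s(3) of_nat_mult of_nat_add of_nat_power of_nat_numeral of_nat_1 by linarith
    qed
  qed
  have "(\<lambda>n. 100 * (real n / ?C0 n) + 200 * (real n / ?C1 n) + 100 * (real n / ?C2 n)) \<longlonglongrightarrow> 100 * 0 + 200 * 0 + 100 * 0"
    by (intro tendsto_add tendsto_mult tendsto_const l0 l1 l2)
  then have bound: "(\<lambda>n. 100 * (real n / ?C0 n) + 200 * (real n / ?C1 n) + 100 * (real n / ?C2 n)) \<longlonglongrightarrow> 0" by simp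
  show ?thesis
  proof (rule tendsto_sandwich[OF _ _ tendsto_const bound])
    show "\<forall>\<^sub>F n in sequentially. 0 \<le> pr (edges r n) (\<lambda>E. \<not> strongly_weighted 2 E)"
      by (simp add: pr_nonneg)
    show "\<forall>\<^sub>F n in sequentially. pr (edges r n) (\<lambda>E. \<not> strongly_weighted 2 E)
        \<le> 100 * (real n / ?C0 n) + 200 * (real n / ?C1 n) + 100 * (real n / ?C2 n)"
      using h1 h2 h3 a6 pos[OF C0] pos[OF C1] pos[OF C2]
    proof eventually_elim
      case (elim n)
      note elim' = elim[unfolded of_nat_mult of_nat_add of_nat_power of_nat_numeral of_nat_1]
      show ?case
        by (intro pr_not_strongly_weighted_2_le[OF r _ refl refl refl]) (use elim' in linarith)+
    qed
  qed
qed

section \<open>Weightings with one weight\<close>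

lemma strongly_weighted_1_iff:
  "strongly_weighted 1 E \<longleftrightarrow> (\<forall>e\<in>E. \<forall>u\<in>e. \<forall>v\<in>e. u \<noteq> v \<longrightarrow> deg E u \<noteq> deg E v)"
proof -
  have col: "induced_colour E \<omega> v = deg E v" if "\<forall>e\<in>E. \<omega> e \<in> {1..1}" for \<omega> v
  proof -
    have "induced_colour E \<omega> v = (\<Sum>e\<in>{e\<in>E. v \<in> e}. 1)"
      unfolding induced_colour_def using that by (intro sum.cong) auto
    then show ?thesis by (simp add: deg_def)
  qed
  show ?thesis
  proof
    assume "strongly_weighted 1 E"
    then obtain \<omega> where "\<forall>e\<in>E. \<omega> e \<in> {1..1}"
      "\<forall>e\<in>E. \<forall>u\<in>e. \<forall>v\<in>e. u \<noteq> v \<longrightarrow> induced_colour E \<omega> u \<noteq> induced_colour E \<omega> v"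
      unfolding strongly_weighted_def by auto
    then show "\<forall>e\<in>E. \<forall>u\<in>e. \<forall>v\<in>e. u \<noteq> v \<longrightarrow> deg E u \<noteq> deg E v"
      using col by metis
  next
    assume *: "\<forall>e\<in>E. \<forall>u\<in>e. \<forall>v\<in>e. u \<noteq> v \<longrightarrow> deg E u \<noteq> deg E v"
    have "\<forall>e\<in>E. (\<lambda>_. 1 :: nat) e \<in> {1..1}" by simp
    from col[OF this] * show "strongly_weighted 1 E"
      unfolding strongly_weighted_def by (intro exI[of _ "\<lambda>_. 1"] conjI) simp_all
  qed
qed

definition all_pairs_covered :: "nat \<Rightarrow> nat set set \<Rightarrow> bool" where
  "all_pairs_covered n E \<longleftrightarrow> (\<forall>p\<in>pairs {1..n}. \<exists>e\<in>E. {fst p, snd p} \<subseteq> e)"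

lemma strongly_weighted_1_if_inj:
  assumes "E \<subseteq> edges r n" "inj_on (deg E) {1..n}"
  shows "strongly_weighted 1 E"
  unfolding strongly_weighted_1_iff
proof (intro ballI impI)
  fix e u v assume e: "e \<in> E" "u \<in> e" "v \<in> e" "u \<noteq> v"
  have "e \<subseteq> {1..n}" using assms(1) e(1) by (auto simp: edges_def)
  then show "deg E u \<noteq> deg E v" using inj_onD[OF assms(2), of u v] e by blast
qed

lemma inj_if_strongly_weighted_1:
  assumes "strongly_weighted 1 E" "all_pairs_covered n E"
  shows "inj_on (deg E) {1..n}"
proof -
  have "deg E u \<noteq> deg E v" if "u \<in> {1..n}" "v \<in> {1..n}" "u < v" for u v
  proof -
    have "(u, v) \<in> pairs {1..n}" using that by (simp add: pairs_def)
    then obtain e where "e \<in> E" "u \<in> e" "v \<in> e"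
      using assms(2) unfolding all_pairs_covered_def by force
    then show ?thesis using assms(1) that(3) unfolding strongly_weighted_1_iff by fastforce
  qed
  then show ?thesis unfolding inj_on_def by (metis linorder_neqE_nat)
qed

text \<open>For r >= 3 and large n a pair has at least n - 2 potential edges, so it is uncovered
  with probability at most 2^-(n - 2), which beats the number of pairs.\<close>

lemma pr_not_all_pairs_covered_tendsto_0:
  assumes r: "3 \<le> r"
  shows "(\<lambda>n. pr (edges r n) (\<lambda>E. \<not> all_pairs_covered n E)) \<longlonglongrightarrow> 0"
proof (rule tendsto_sandwich[OF _ _ tendsto_const])
  show "\<forall>\<^sub>F n in sequentially. 0 \<le> pr (edges r n) (\<lambda>E. \<not> all_pairs_covered n E)"
    by (simp add: pr_nonneg)
  show "(\<lambda>n. real n ^ 2 * (1 / 2 ^ (n - 2))) \<longlonglongrightarrow> 0" by real_asymp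
  show "\<forall>\<^sub>F n in sequentially. pr (edges r n) (\<lambda>E. \<not> all_pairs_covered n E) \<le> real n ^ 2 * (1 / 2 ^ (n - 2))"
    \<comment> \<open>This keeps r - 2 in the increasing half of the binomial row n - 2.\<close>
    using eventually_ge_at_top[of "2 * r"]
  proof eventually_elim
    case (elim n)
    let ?D = "\<lambda>p. {e\<in>edges r n. {fst p, snd p} \<subseteq> e}"
    have "pr (edges r n) (\<lambda>E. \<not> all_pairs_covered n E) \<le> pr (edges r n) (\<lambda>E. \<exists>p\<in>pairs {1..n}. E \<inter> ?D p = {})"
      unfolding all_pairs_covered_def by (rule pr_mono) blast
    also have "\<dots> \<le> card (pairs {1..n}) * (1 / 2 ^ (n - 2))"
    proof (rule pr_bex_le_const)
      fix p assume "p \<in> pairs {1..n}"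
      then have p: "card {fst p, snd p} = 2" "{fst p, snd p} \<subseteq> {1..n}" by (auto simp: pairs_def)
      have "n - 2 = (n - 2) choose 1" by simp
      also have "\<dots> \<le> (n - 2) choose (r - 2)" using elim r by (intro binomial_mono) auto
      also have "\<dots> = card (?D p)" using card_edges_superset[OF p(2)] p(1) r by simp
      finally have "1 / 2 ^ card (?D p) \<le> (1 / 2 ^ (n - 2) :: real)"
        by (intro divide_left_mono power_increasing) auto
      moreover have "pr (edges r n) (\<lambda>E. E \<inter> ?D p = {}) = pr (?D p) (\<lambda>X. X = {})"
        unfolding pr_def by (rule avg_Int[where f = "\<lambda>X. of_bool (X = {})"]) auto
      moreover have "pr (?D p) (\<lambda>X. X = {}) = pr (?D p) (\<lambda>X. card X = 0)"
      proof (rule pr_cong)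
        fix X assume "X \<subseteq> ?D p"
        then have "finite X" by (rule finite_subset) simp
        then show "(X = {}) = (card X = 0)" by simp
      qed
      moreover have "pr (?D p) (\<lambda>X. card X = 0) = 1 / 2 ^ card (?D p)"
        by (subst pr_card_eq) auto
      ultimately show "pr (edges r n) (\<lambda>E. E \<inter> ?D p = {}) \<le> 1 / 2 ^ (n - 2)" by linarith
    qed simp
    also have "\<dots> \<le> real n ^ 2 * (1 / 2 ^ (n - 2))"
      using choose_le_power[of n 2] by (intro mult_right_mono) (simp_all add: card_pairs flip: of_nat_power)
    finally show ?case .
  qed
qed

section \<open>The three ranges of \<open>r\<close>\<close>

lemma frac_with_eq_pr: "frac_with r P n = pr (edges r n) P"
proof -
  have "uniform_hypergraphs r n = Pow (edges r n)"
    by (simp add: uniform_hypergraphs_def edges_def)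
  then show ?thesis by (simp add: frac_with_def pr_eq_card card_edges)
qed

lemma pr_strongly_weighted_1_bounds:
  "pr (edges r n) (\<lambda>E. inj_on (deg E) {1..n}) \<le> pr (edges r n) (strongly_weighted 1)"
  "pr (edges r n) (strongly_weighted 1) \<le> pr (edges r n) (\<lambda>E. inj_on (deg E) {1..n}) + pr (edges r n) (\<lambda>E. \<not> all_pairs_covered n E)"
proof -
  show "pr (edges r n) (\<lambda>E. inj_on (deg E) {1..n}) \<le> pr (edges r n) (strongly_weighted 1)"
    by (rule pr_mono) (rule strongly_weighted_1_if_inj)
  have "pr (edges r n) (strongly_weighted 1) \<le> pr (edges r n) (\<lambda>E. inj_on (deg E) {1..n} \<or> \<not> all_pairs_covered n E)"
    using inj_if_strongly_weighted_1 by (intro pr_mono) blast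
  also have "\<dots> \<le> pr (edges r n) (\<lambda>E. inj_on (deg E) {1..n}) + pr (edges r n) (\<lambda>E. \<not> all_pairs_covered n E)"
    by (rule pr_or_le)
  finally show "pr (edges r n) (strongly_weighted 1) \<le> pr (edges r n) (\<lambda>E. inj_on (deg E) {1..n}) + pr (edges r n) (\<lambda>E. \<not> all_pairs_covered n E)" .
qed

text \<open>For r = 5 the full vertex set is exactly critical, since n^2 = sqrt(n^4). The rate is
  sqrt(4!/pi)/2 = sqrt(6/pi).\<close>

lemma pr_5_strongly_weighted_1: "(\<lambda>n. pr (edges 5 n) (strongly_weighted 1)) \<longlonglongrightarrow> exp (- sqrt (6 / pi))"
proof -
  interpret collision_window 5 "\<lambda>n. n" 1
  proof
    show "(\<lambda>n. (real n)\<^sup>2 / sqrt (real n ^ (5 - 1))) \<longlonglongrightarrow> 1" by simp real_asymp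
  qed (auto simp: filterlim_ident)
  have "sqrt (fact (5 - 1) / pi) = sqrt (2\<^sup>2 * (6 / pi))"
    by (simp add: fact_numeral)
  also have "\<dots> = 2 * sqrt (6 / pi)" by (subst real_sqrt_mult) simp
  finally have "rate = sqrt (6 / pi)" unfolding rate_def by simp
  then have inj: "(\<lambda>n. pr (edges 5 n) (\<lambda>E. inj_on (deg E) {1..n})) \<longlonglongrightarrow> exp (- sqrt (6 / pi))"
    using pr_degrees_inj_tendsto by simp
  have "(\<lambda>n. pr (edges 5 n) (\<lambda>E. inj_on (deg E) {1..n}) + pr (edges 5 n) (\<lambda>E. \<not> all_pairs_covered n E))
      \<longlonglongrightarrow> exp (- sqrt (6 / pi)) + 0"
    by (intro tendsto_add inj pr_not_all_pairs_covered_tendsto_0) simp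
  then have up: "(\<lambda>n. pr (edges 5 n) (\<lambda>E. inj_on (deg E) {1..n}) + pr (edges 5 n) (\<lambda>E. \<not> all_pairs_covered n E))
      \<longlonglongrightarrow> exp (- sqrt (6 / pi))" by simp
  show ?thesis
    by (rule tendsto_sandwich[OF _ _ inj up]) (simp_all only: pr_strongly_weighted_1_bounds eventually_True)
qed

text \<open>A window of \<open>c n\<^bsup>(r - 1)/4\<^esup>\<close> vertices already contains a pair of equal degree with
  probability close to one when \<open>c\<close> is large.\<close>

lemma pr_strongly_weighted_1_tendsto_0:
  assumes r34: "r \<in> {3, 4}"
  shows "(\<lambda>n. pr (edges r n) (strongly_weighted 1)) \<longlonglongrightarrow> 0"
proof (rule LIMSEQ_I)
  fix e :: real assume e: "0 < e"
  \<comment> \<open>Chosen so that the window with constant c has rate c^2 k.\<close>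
  define k where "k = sqrt (fact (r - 1) / pi) / 2"
  have k: "0 < k" by (simp add: k_def)
  have "((\<lambda>c. exp (- (c\<^sup>2 * k))) \<longlongrightarrow> 0) at_top" using k by real_asymp
  then have "\<forall>\<^sub>F c in at_top. exp (- (c\<^sup>2 * k)) < e / 2"
    by (rule order_tendstoD) (use e in simp)
  with eventually_gt_at_top[of "0 :: real"]
  have "\<forall>\<^sub>F c in at_top. 0 < c \<and> exp (- (c\<^sup>2 * k)) < e / 2" by (rule eventually_conj)
  then obtain c :: real where c: "0 < c" "exp (- (c\<^sup>2 * k)) < e / 2"
    using eventually_happens'[OF trivial_limit_at_top_linorder] by blast
  define x where "x = (\<lambda>n::nat. real_of_int \<lfloor>c * real n powr ((real r - 1) / 4)\<rfloor>)"
  \<comment> \<open>The window must lie in the vertex set for every n, whereas the floor is at most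
    n only eventually; the minimum does not affect large n.\<close>
  define m where "m = (\<lambda>n. min n (nat \<lfloor>c * real n powr ((real r - 1) / 4)\<rfloor>))"
  have x: "\<forall>\<^sub>F n in sequentially. x n \<le> real n" "filterlim x at_top sequentially"
    "(\<lambda>n. (x n)\<^sup>2 / sqrt (real n ^ (r - 1))) \<longlonglongrightarrow> c\<^sup>2"
    using r34 c(1) unfolding x_def by (auto; real_asymp)+
  have m_eq: "\<forall>\<^sub>F n in sequentially. real (m n) = x n"
    using x(1)
  proof eventually_elim
    case (elim n)
    have floor: "real (nat \<lfloor>c * real n powr ((real r - 1) / 4)\<rfloor>) = x n"
      using c(1) by (simp add: x_def)
    then have "nat \<lfloor>c * real n powr ((real r - 1) / 4)\<rfloor> \<le> n" using elim by linarith
    then show ?case unfolding m_def floor[symmetric] by (simp only: min_absorb2)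
  qed
  interpret collision_window r m "c\<^sup>2"
  proof
    show "2 \<le> r" using r34 by auto
    show "m n \<le> n" for n by (simp add: m_def)
    have "filterlim (\<lambda>n. real (m n)) at_top sequentially"
      using x(2) filterlim_cong[OF refl refl m_eq] by simp
    then show "filterlim m at_top sequentially"
      by (simp only: filterlim_sequentially_iff_filterlim_real)
    show "(\<lambda>n. (real (m n))\<^sup>2 / sqrt (real n ^ (r - 1))) \<longlonglongrightarrow> c\<^sup>2"
      using m_eq by (intro Lim_transform_eventually[OF x(3)]) (auto elim: eventually_mono)
  qed
  have rate: "rate = c\<^sup>2 * k" by (simp add: rate_def k_def)
  have "\<forall>\<^sub>F n in sequentially. pr (edges r n) (\<lambda>E. inj_on (deg E) {1..m n}) < e / 2"
    by (rule order_tendstoD[OF pr_degrees_inj_tendsto]) (unfold rate, rule c(2))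
  moreover have "\<forall>\<^sub>F n in sequentially. pr (edges r n) (\<lambda>E. \<not> all_pairs_covered n E) < e / 2"
    by (rule order_tendstoD[OF pr_not_all_pairs_covered_tendsto_0]) (use r34 e in auto)
  ultimately have "\<forall>\<^sub>F n in sequentially. norm (pr (edges r n) (strongly_weighted 1) - 0) < e"
  proof eventually_elim
    case (elim n)
    have "pr (edges r n) (\<lambda>E. inj_on (deg E) {1..n}) \<le> pr (edges r n) (\<lambda>E. inj_on (deg E) {1..m n})"
      using m_le[of n] by (intro pr_mono) (auto elim: inj_on_subset)
    then show ?case
      using elim pr_strongly_weighted_1_bounds(2)[of r n] pr_nonneg[of "edges r n" "strongly_weighted 1"] by simp
  qed
  then show "\<exists>N. \<forall>n\<ge>N. norm (pr (edges r n) (strongly_weighted 1) - 0) < e"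
    by (simp add: eventually_sequentially)
qed

text \<open>The first moment suffices: n^2 pairs against a coincidence probability O(n^(-5/2)). For
  r > 6 the block size only grows, so the estimate for r - 1 = 5 covers every case.\<close>

lemma pr_not_strongly_weighted_1_tendsto_0:
  assumes r: "6 \<le> r"
  shows "(\<lambda>n. pr (edges r n) (\<lambda>E. \<not> strongly_weighted 1 E)) \<longlonglongrightarrow> 0"
proof (rule tendsto_sandwich[OF _ _ tendsto_const])
  show "\<forall>\<^sub>F n in sequentially. 0 \<le> pr (edges r n) (\<lambda>E. \<not> strongly_weighted 1 E)"
    by (simp add: pr_nonneg)
  have "(\<lambda>n. real n ^ 2 / sqrt (real n ^ 5)) \<longlonglongrightarrow> 0" by real_asymp
  moreover have "(\<lambda>n. sqrt (real ((n - 2) choose 5) / real n ^ 5)) \<longlonglongrightarrow> sqrt (1 / fact 5)"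
    by (rule tendsto_real_sqrt[OF tendsto_choose_over_power])
  ultimately have "(\<lambda>n. real n ^ 2 / sqrt (real n ^ 5) / sqrt (real ((n - 2) choose 5) / real n ^ 5)) \<longlonglongrightarrow> 0 / sqrt (1 / fact 5)"
    by (rule tendsto_divide) simp
  moreover have "\<forall>\<^sub>F n in sequentially. real n ^ 2 / sqrt (real n ^ 5) / sqrt (real ((n - 2) choose 5) / real n ^ 5)
      = real n ^ 2 * (1 / sqrt (real ((n - 2) choose 5)))"
    using eventually_gt_at_top[of 0] by eventually_elim (simp add: real_sqrt_divide)
  ultimately show "(\<lambda>n. real n ^ 2 * (1 / sqrt (real ((n - 2) choose 5)))) \<longlonglongrightarrow> 0"
    by (simp add: Lim_transform_eventually)
  show "\<forall>\<^sub>F n in sequentially. pr (edges r n) (\<lambda>E. \<not> strongly_weighted 1 E) \<le> real n ^ 2 * (1 / sqrt (real ((n - 2) choose 5)))"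
    using eventually_ge_at_top[of "2 * r"]
  proof eventually_elim
    case (elim n)
    have "pr (edges r n) (\<lambda>E. \<not> strongly_weighted 1 E)
        \<le> pr (edges r n) (\<lambda>E. \<exists>p\<in>pairs {1..n}. \<forall>a\<in>{fst p}. deg E a = deg E (snd p))"
    proof (rule pr_mono)
      fix E assume E: "E \<subseteq> edges r n" "\<not> strongly_weighted 1 E"
      then have "\<not> inj_on (deg E) {1..n}" using strongly_weighted_1_if_inj by blast
      then obtain u v where "u \<in> {1..n}" "v \<in> {1..n}" "deg E u = deg E v" "u < v"
        unfolding inj_on_def by (metis linorder_neqE_nat)
      then show "\<exists>p\<in>pairs {1..n}. \<forall>a\<in>{fst p}. deg E a = deg E (snd p)"
        by (intro bexI[of _ "(u, v)"]) (auto simp: pairs_def)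
    qed
    also have "\<dots> \<le> card (pairs {1..n}) * (1 / sqrt (real ((n - 2) choose 5)))"
    proof (rule pr_bex_le_const)
      fix p assume p: "p \<in> pairs {1..n}"
      have card: "card {fst p, snd p} = 2" using p by (auto simp: pairs_def)
      have "pr (edges r n) (\<lambda>E. \<forall>a\<in>{fst p}. deg E a = deg E (snd p))
          \<le> (1 / sqrt (((n - card {fst p, snd p}) choose (r - 1)) + 1)) ^ card {fst p}"
        using p r by (intro pr_degrees_eq_le) (auto simp: pairs_def)
      also have "\<dots> = 1 / sqrt (((n - 2) choose (r - 1)) + 1)"
        unfolding card by simp
      also have "\<dots> \<le> 1 / sqrt (real ((n - 2) choose 5))"
      proof (rule divide_left_mono)
        have "(n - 2) choose 5 \<le> (n - 2) choose (r - 1)"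
          using elim r by (intro binomial_mono) auto
        then show "sqrt (real ((n - 2) choose 5)) \<le> sqrt (real (((n - 2) choose (r - 1)) + 1))"
          by simp
        have "5 \<le> n - 2" using elim r by simp
        then have "0 < (n - 2) choose 5" by (rule zero_less_binomial)
        then show "0 < sqrt (real ((n - 2 choose (r - 1)) + 1)) * sqrt (real ((n - 2) choose 5))"
          by (intro mult_pos_pos) auto
      qed simp
      finally show "pr (edges r n) (\<lambda>E. \<forall>a\<in>{fst p}. deg E a = deg E (snd p)) \<le> 1 / sqrt (real ((n - 2) choose 5))" .
    qed simp
    also have "\<dots> \<le> real n ^ 2 * (1 / sqrt (real ((n - 2) choose 5)))"
      using choose_le_power[of n 2] by (intro mult_right_mono) (simp_all add: card_pairs flip: of_nat_power)
    finally show ?case .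
  qed
qed

theorem theorem1p2:
  shows "(\<forall>r\<in>{3,4}. almost_all r (\<lambda>E. strongly_weighted 2 E \<and> \<not> strongly_weighted 1 E))
    \<and> (frac_with 5 (strongly_weighted 1) \<longlonglongrightarrow> exp (- sqrt (6 / pi)))
    \<and> (frac_with 5 (\<lambda>E. strongly_weighted 2 E \<and> \<not> strongly_weighted 1 E)
         \<longlonglongrightarrow> 1 - exp (- sqrt (6 / pi)))
    \<and> (\<forall>r\<ge>6. almost_all r (strongly_weighted 1))"
proof (intro conjI ballI allI impI)
  fix r :: nat assume r: "r \<in> {3, 4}"
  have "(\<lambda>n. pr (edges r n) (\<lambda>E. \<not> strongly_weighted 2 E) + pr (edges r n) (strongly_weighted 1)) \<longlonglongrightarrow> 0 + 0"
    using r by (intro tendsto_add pr_not_strongly_weighted_2_tendsto_0 pr_strongly_weighted_1_tendsto_0) auto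
  then have up: "(\<lambda>n. pr (edges r n) (\<lambda>E. \<not> strongly_weighted 2 E) + pr (edges r n) (strongly_weighted 1)) \<longlonglongrightarrow> 0"
    by simp
  have le: "pr (edges r n) (\<lambda>E. \<not> (strongly_weighted 2 E \<and> \<not> strongly_weighted 1 E))
      \<le> pr (edges r n) (\<lambda>E. \<not> strongly_weighted 2 E) + pr (edges r n) (strongly_weighted 1)" for n
    using pr_or_le[of "edges r n" "\<lambda>E. \<not> strongly_weighted 2 E" "strongly_weighted 1"] by simp
  show "almost_all r (\<lambda>E. strongly_weighted 2 E \<and> \<not> strongly_weighted 1 E)"
    unfolding almost_all_def frac_with_eq_pr[abs_def]
    by (rule tendsto_sandwich[OF _ _ tendsto_const up]) (simp_all only: pr_nonneg le eventually_True)
next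
  show one: "frac_with 5 (strongly_weighted 1) \<longlonglongrightarrow> exp (- sqrt (6 / pi))"
    unfolding frac_with_eq_pr[abs_def] by (rule pr_5_strongly_weighted_1)
  have compl: "(\<lambda>n. 1 - pr (edges 5 n) (strongly_weighted 1)) \<longlonglongrightarrow> 1 - exp (- sqrt (6 / pi))"
    by (intro tendsto_diff tendsto_const pr_5_strongly_weighted_1)
  then have low: "(\<lambda>n. 1 - pr (edges 5 n) (strongly_weighted 1) - pr (edges 5 n) (\<lambda>E. \<not> strongly_weighted 2 E)) \<longlonglongrightarrow> 1 - exp (- sqrt (6 / pi))"
    using tendsto_diff[OF compl pr_not_strongly_weighted_2_tendsto_0[of 5]] by simp
  let ?p = "\<lambda>n. pr (edges 5 n) (\<lambda>E. strongly_weighted 2 E \<and> \<not> strongly_weighted 1 E)"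
  have le: "?p n \<le> 1 - pr (edges 5 n) (strongly_weighted 1)" for n
    unfolding pr_compl[OF finite_edges, symmetric] by (rule pr_mono) simp
  \<comment> \<open>Failing to be strongly 1-weighted leaves only the desired event or the rare
    failure with two weights.\<close>
  have ge: "1 - pr (edges 5 n) (strongly_weighted 1) - pr (edges 5 n) (\<lambda>E. \<not> strongly_weighted 2 E) \<le> ?p n" for n
  proof -
    have "pr (edges 5 n) (\<lambda>E. \<not> strongly_weighted 1 E)
        \<le> pr (edges 5 n) (\<lambda>E. (strongly_weighted 2 E \<and> \<not> strongly_weighted 1 E) \<or> \<not> strongly_weighted 2 E)"
      by (rule pr_mono) blast
    also have "\<dots> \<le> ?p n + pr (edges 5 n) (\<lambda>E. \<not> strongly_weighted 2 E)" by (rule pr_or_le)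
    finally show ?thesis by (simp add: pr_compl)
  qed
  show "frac_with 5 (\<lambda>E. strongly_weighted 2 E \<and> \<not> strongly_weighted 1 E) \<longlonglongrightarrow> 1 - exp (- sqrt (6 / pi))"
    unfolding frac_with_eq_pr[abs_def]
    by (rule tendsto_sandwich[OF _ _ low compl]) (simp_all only: le ge eventually_True)
next
  fix r :: nat assume "6 \<le> r"
  then show "almost_all r (strongly_weighted 1)"
    unfolding almost_all_def frac_with_eq_pr[abs_def] by (rule pr_not_strongly_weighted_1_tendsto_0)
qed

end
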